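(* Let $R=S/I$ be such that the Yoneda algebra $\operatorname{Ext}_R(\mathsf k,\mathsf k)$ is generated as a $\mathsf k$-algebra by its elements of cohomological degrees $1$ and $2$. Then $R$ has minimal rate and minimal slant, i.e. $\operatorname{rate}(R)=m(I)-1$ and $\operatorname{slant}(R)=\frac{m(I)}{2}$.
   Context: $\mathsf k$ is a field, $n\ge 2$, $S=\mathsf k[x_1,\dots,x_n]$ is standard graded, $I$ is a nonzero homogeneous ideal of $S$ contained in $(x_1,\dots,x_n)^2$, $R=S/I$, and $m(I)$ is the largest degree of a minimal generator of $I$. For $i\ge 0$ let $t_i^R(\mathsf k)=\sup\{j: \operatorname{Tor}_i^R(\mathsf k,\mathsf k)_j\ne 0\}$, where $j$ is the internal degree. Define $$\operatorname{rate}(R)=\sup_{i\ge 2}\frac{t_i^R(\mathsf k)-1}{i-1},\qquad \operatorname{slant}(R)=\sup_{i\ge 1}\frac{t_i^R(\mathsf k)}{i}.$$ $R$ has minimal rate if $\operatorname{rate}(R)=m(I)-1$, and minimal slant if $\operatorname{slant}(R)=m(I)/2$. $\operatorname{Ext}_R(\mathsf k,\mathsf k)$ is a bigraded $\mathsf k$-algebra with the Yoneda product. *)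

theory Defs
  imports
    "HOL-Library.Poly_Mapping"
    "HOL-Library.Extended_Real"
    "HOL-Library.Cardinality"
begin

section \<open>The polynomial ring\<close>

text \<open>
  The variables are indexed by a finite type \<open>'x\<close>, so that the whole type \<open>('x, 'k) mpoly\<close> is the
  ring \<open>S = k[x\<^sub>1, \<dots>, x\<^sub>n]\<close> with \<open>n = CARD('x)\<close>; its ring structure is the convolution product
  of \<^theory>\<open>HOL-Library.Poly_Mapping\<close>.
\<close>

type_synonym ('x, 'k) mpoly = "('x \<Rightarrow>\<^sub>0 nat) \<Rightarrow>\<^sub>0 'k"

definition mvar :: "'x \<Rightarrow> ('x, 'k::field) mpoly"
  where "mvar i = Poly_Mapping.single (Poly_Mapping.single i 1) 1"

text \<open>Zero is homogeneous of every degree.\<close>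

definition homogeneous :: "nat \<Rightarrow> ('x::finite, 'k::field) mpoly \<Rightarrow> bool"
  where "homogeneous e p \<longleftrightarrow>
    (\<forall>m \<in> Poly_Mapping.keys p. (\<Sum>i\<in>UNIV. Poly_Mapping.lookup m i) = e)"

text \<open>Ideals are the submodules of the ring over itself.\<close>

abbreviation ideal_gen :: "'a::comm_ring_1 set \<Rightarrow> 'a set"
  where "ideal_gen \<equiv> module.span (*)"

definition homogeneous_ideal :: "('x::finite, 'k::field) mpoly set \<Rightarrow> bool"
  where "homogeneous_ideal I \<longleftrightarrow>
    (\<exists>G. (\<forall>g\<in>G. \<exists>e. homogeneous e g) \<and> I = ideal_gen G)"

definition irrelevant_ideal :: "('x::finite, 'k::field) mpoly set"
  where "irrelevant_ideal = ideal_gen (mvar ` UNIV)"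

definition irrelevant_ideal_sq :: "('x::finite, 'k::field) mpoly set"
  where "irrelevant_ideal_sq =
    ideal_gen {a * b | a b. a \<in> irrelevant_ideal \<and> b \<in> irrelevant_ideal}"

definition minimal_generators ::
    "('x::finite, 'k::field) mpoly set \<Rightarrow> ('x, 'k) mpoly set \<Rightarrow> bool"
  where "minimal_generators I G \<longleftrightarrow>
    (\<forall>g\<in>G. \<exists>e. homogeneous e g) \<and> ideal_gen G = I \<and> (\<forall>H. H \<subset> G \<longrightarrow> ideal_gen H \<noteq> I)"

text \<open>
  The invariant \<open>m(I)\<close>.  By the graded Nakayama lemma the degrees which occur do not depend on the
  choice of \<open>G\<close>, and by Hilbert's basis theorem there are finitely many of them, so for \<open>I \<noteq> 0\<close> the
  supremum is a maximum; it is taken in \<^typ>\<open>ereal\<close>, where \<open>rate\<close> and \<open>slant\<close> live.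
\<close>

definition max_gen_degree :: "('x::finite, 'k::field) mpoly set \<Rightarrow> ereal"
  where "max_gen_degree I =
    Sup {ereal (real e) | e G g. minimal_generators I G \<and> g \<in> G \<and> homogeneous e g}"


section \<open>The quotient ring\<close>

text \<open>
  The ring \<open>R = S/I\<close> is given, up to isomorphism, as a ring \<open>'r\<close> together with a surjective ring
  homomorphism \<open>\<pi> : S \<rightarrow> R\<close> whose kernel is \<open>I\<close>.
\<close>

definition quotient_map ::
    "('x::finite, 'k::field) mpoly set \<Rightarrow> (('x, 'k) mpoly \<Rightarrow> 'r::comm_ring_1) \<Rightarrow> bool"
  where "quotient_map I \<pi> \<longleftrightarrow>
    (\<forall>p q. \<pi> (p + q) = \<pi> p + \<pi> q) \<and> (\<forall>p q. \<pi> (p * q) = \<pi> p * \<pi> q) \<and> \<pi> 1 = 1 \<and>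
    surj \<pi> \<and> {p. \<pi> p = 0} = I"

definition R_graded ::
    "(('x::finite, 'k::field) mpoly \<Rightarrow> 'r::comm_ring_1) \<Rightarrow> nat \<Rightarrow> 'r set"
  where "R_graded \<pi> e = \<pi> ` {p. homogeneous e p}"

text \<open>
  The augmentation \<open>R \<rightarrow> k\<close>: the constant coefficient of a representative, which does not depend on the
  representative as soon as \<open>I\<close> is contained in the irrelevant ideal.  It defines the \<open>R\<close>-module \<open>k\<close>.
\<close>

definition to_k :: "(('x::finite, 'k::field) mpoly \<Rightarrow> 'r::comm_ring_1) \<Rightarrow> 'r \<Rightarrow> 'k"
  where "to_k \<pi> r = Poly_Mapping.lookup (inv \<pi> r) 0"

definition k_scale ::
    "(('x::finite, 'k::field) mpoly \<Rightarrow> 'r::comm_ring_1) \<Rightarrow> 'r \<Rightarrow> 'k \<Rightarrow> 'k"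
  where "k_scale \<pi> r c = to_k \<pi> r * c"


section \<open>Graded free resolutions of \<open>k\<close>\<close>

text \<open>
  A complex \<open>F\<close> of graded free \<open>R\<close>-modules is stored as the direct sum of its terms, that is, as the
  free \<open>R\<close>-module \<open>'b \<Rightarrow>\<^sub>0 'r\<close> on a homogeneous basis \<open>'b\<close>.  The basis element \<open>b\<close> lies in the term
  \<open>F\<^sub>i\<close>, \<open>i = hdeg F b\<close>, and spans there a copy of \<open>R(-a)\<close>, \<open>a = ideg F b\<close>.  The family of
  differentials is one endomorphism of the sum, and the augmentation \<open>F\<^sub>0 \<rightarrow> k\<close> is extended by zero
  to the other terms.
\<close>

record (overloaded) ('r, 'b, 'k) free_complex =
  hdeg :: "'b \<Rightarrow> nat"
  ideg :: "'b \<Rightarrow> int"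
  diff :: "('b \<Rightarrow>\<^sub>0 'r) \<Rightarrow> ('b \<Rightarrow>\<^sub>0 'r)"
  augm :: "('b \<Rightarrow>\<^sub>0 'r) \<Rightarrow> 'k"

definition free_scale :: "'r::comm_ring_1 \<Rightarrow> ('b \<Rightarrow>\<^sub>0 'r) \<Rightarrow> ('b \<Rightarrow>\<^sub>0 'r)"
  where "free_scale r = Poly_Mapping.map ((*) r)"

definition R_endomorphism :: "(('b \<Rightarrow>\<^sub>0 'r::comm_ring_1) \<Rightarrow> ('b \<Rightarrow>\<^sub>0 'r)) \<Rightarrow> bool"
  where "R_endomorphism \<phi> \<longleftrightarrow> module_hom free_scale free_scale \<phi>"

definition R_form ::
    "(('x::finite, 'k::field) mpoly \<Rightarrow> 'r::comm_ring_1) \<Rightarrow> (('b \<Rightarrow>\<^sub>0 'r) \<Rightarrow> 'k) \<Rightarrow> bool"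
  where "R_form \<pi> f \<longleftrightarrow> module_hom free_scale (k_scale \<pi>) f"

definition F_term :: "('r::comm_ring_1, 'b, 'k::field) free_complex \<Rightarrow> nat \<Rightarrow> ('b \<Rightarrow>\<^sub>0 'r) set"
  where "F_term F i = {v. \<forall>b \<in> Poly_Mapping.keys v. hdeg F b = i}"

definition F_graded ::
    "(('x::finite, 'k::field) mpoly \<Rightarrow> 'r::comm_ring_1) \<Rightarrow> ('r, 'b, 'k) free_complex
      \<Rightarrow> nat \<Rightarrow> int \<Rightarrow> ('b \<Rightarrow>\<^sub>0 'r) set"
  where "F_graded \<pi> F i j = {v \<in> F_term F i. \<forall>b \<in> Poly_Mapping.keys v.
    \<exists>e. ideg F b + int e = j \<and> Poly_Mapping.lookup v b \<in> R_graded \<pi> e}"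

definition graded_free_resolution ::
    "(('x::finite, 'k::field) mpoly \<Rightarrow> 'r::comm_ring_1) \<Rightarrow> ('r, 'b, 'k) free_complex \<Rightarrow> bool"
  where "graded_free_resolution \<pi> F \<longleftrightarrow>
    R_endomorphism (diff F) \<and> R_form \<pi> (augm F) \<and>
    \<comment> \<open>the maps are homogeneous of internal degree 0, with \<open>k\<close> placed in degree 0\<close>
    (\<forall>i j. diff F ` F_graded \<pi> F (Suc i) j \<subseteq> F_graded \<pi> F i j) \<and>
    (\<forall>v \<in> F_term F 0. diff F v = 0) \<and>
    (\<forall>j. j \<noteq> 0 \<longrightarrow> (\<forall>v \<in> F_graded \<pi> F 0 j. augm F v = 0)) \<and>
    (\<forall>i. i \<noteq> 0 \<longrightarrow> (\<forall>v \<in> F_term F i. augm F v = 0)) \<and>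
    \<comment> \<open>exactness of \<open>\<dots> \<rightarrow> F\<^sub>2 \<rightarrow> F\<^sub>1 \<rightarrow> F\<^sub>0 \<rightarrow> k \<rightarrow> 0\<close>\<close>
    surj (augm F) \<and>
    {v \<in> F_term F 0. augm F v = 0} = diff F ` F_term F 1 \<and>
    (\<forall>i. {v \<in> F_term F (Suc i). diff F v = 0} = diff F ` F_term F (Suc (Suc i)))"


section \<open>Tor\<close>

text \<open>
  Under \<open>F \<otimes>\<^sub>R k = ('b \<Rightarrow>\<^sub>0 'k)\<close>, the map \<open>v \<mapsto> v \<otimes> 1\<close> applies the augmentation to the coefficients.  It is
  surjective and commutes with the differentials, so cycles and boundaries of \<open>F \<otimes>\<^sub>R k\<close> in homological
  degree \<open>i\<close> and internal degree \<open>j\<close> can be written as images of elements of \<open>F\<close>.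
  The graded piece \<open>Tor\<^sub>i\<^sup>R(k,k)\<^sub>j\<close> is cycles modulo boundaries.
\<close>

definition tensor_k ::
    "(('x::finite, 'k::field) mpoly \<Rightarrow> 'r::comm_ring_1) \<Rightarrow> ('b \<Rightarrow>\<^sub>0 'r) \<Rightarrow> ('b \<Rightarrow>\<^sub>0 'k)"
  where "tensor_k \<pi> = Poly_Mapping.map (to_k \<pi>)"

definition Tor_cycles ::
    "(('x::finite, 'k::field) mpoly \<Rightarrow> 'r::comm_ring_1) \<Rightarrow> ('r, 'b, 'k) free_complex
      \<Rightarrow> nat \<Rightarrow> int \<Rightarrow> ('b \<Rightarrow>\<^sub>0 'k) set"
  where "Tor_cycles \<pi> F i j =
    {tensor_k \<pi> v | v. v \<in> F_graded \<pi> F i j \<and> tensor_k \<pi> (diff F v) = 0}"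

definition Tor_boundaries ::
    "(('x::finite, 'k::field) mpoly \<Rightarrow> 'r::comm_ring_1) \<Rightarrow> ('r, 'b, 'k) free_complex
      \<Rightarrow> nat \<Rightarrow> int \<Rightarrow> ('b \<Rightarrow>\<^sub>0 'k) set"
  where "Tor_boundaries \<pi> F i j = {tensor_k \<pi> (diff F w) | w. w \<in> F_graded \<pi> F (Suc i) j}"

definition Tor_nonzero ::
    "(('x::finite, 'k::field) mpoly \<Rightarrow> 'r::comm_ring_1) \<Rightarrow> ('r, 'b, 'k) free_complex
      \<Rightarrow> nat \<Rightarrow> int \<Rightarrow> bool"
  where "Tor_nonzero \<pi> F i j \<longleftrightarrow> Tor_cycles \<pi> F i j \<noteq> Tor_boundaries \<pi> F i j"

text \<open>Suprema are taken in \<^typ>\<open>ereal\<close>; in particular \<open>t\<^sub>i = - \<infinity>\<close> if \<open>Tor\<^sub>i = 0\<close>.\<close>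

definition t_deg ::
    "(('x::finite, 'k::field) mpoly \<Rightarrow> 'r::comm_ring_1) \<Rightarrow> ('r, 'b, 'k) free_complex
      \<Rightarrow> nat \<Rightarrow> ereal"
  where "t_deg \<pi> F i = Sup {ereal (real_of_int j) | j. Tor_nonzero \<pi> F i j}"

definition rate ::
    "(('x::finite, 'k::field) mpoly \<Rightarrow> 'r::comm_ring_1) \<Rightarrow> ('r, 'b, 'k) free_complex \<Rightarrow> ereal"
  where "rate \<pi> F = (SUP i \<in> {2..}. (t_deg \<pi> F i - 1) / ereal (real i - 1))"

definition slant ::
    "(('x::finite, 'k::field) mpoly \<Rightarrow> 'r::comm_ring_1) \<Rightarrow> ('r, 'b, 'k) free_complex \<Rightarrow> ereal"
  where "slant \<pi> F = (SUP i \<in> {1..}. t_deg \<pi> F i / ereal (real i))"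


section \<open>The Yoneda algebra\<close>

text \<open>
  An element of \<open>\<Oplus>\<^sub>i Hom\<^sub>R(F\<^sub>i, k)\<close> is an \<open>R\<close>-linear map \<open>F \<rightarrow> k\<close> which vanishes on almost all terms.
  \<open>Ext\<^sub>R(k,k) = \<Oplus>\<^sub>i Ext\<^sub>R\<^sup>i(k,k)\<close> is the cohomology of this complex, with differential \<open>h \<mapsto> h \<circ> diff F\<close>.
\<close>

definition cochains ::
    "(('x::finite, 'k::field) mpoly \<Rightarrow> 'r::comm_ring_1) \<Rightarrow> ('r, 'b, 'k) free_complex
      \<Rightarrow> (('b \<Rightarrow>\<^sub>0 'r) \<Rightarrow> 'k) set"
  where "cochains \<pi> F = {f. R_form \<pi> f \<and> (\<exists>N. \<forall>i>N. \<forall>v \<in> F_term F i. f v = 0)}"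

definition cocycles ::
    "(('x::finite, 'k::field) mpoly \<Rightarrow> 'r::comm_ring_1) \<Rightarrow> ('r, 'b, 'k) free_complex
      \<Rightarrow> (('b \<Rightarrow>\<^sub>0 'r) \<Rightarrow> 'k) set"
  where "cocycles \<pi> F = {f \<in> cochains \<pi> F. \<forall>v. f (diff F v) = 0}"

definition cohomologous ::
    "(('x::finite, 'k::field) mpoly \<Rightarrow> 'r::comm_ring_1) \<Rightarrow> ('r, 'b, 'k) free_complex
      \<Rightarrow> ((('b \<Rightarrow>\<^sub>0 'r) \<Rightarrow> 'k) \<times> (('b \<Rightarrow>\<^sub>0 'r) \<Rightarrow> 'k)) set"
  where "cohomologous \<pi> F = {(f, g). f \<in> cocycles \<pi> F \<and> g \<in> cocycles \<pi> F \<and>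
    (\<exists>h \<in> cochains \<pi> F. \<forall>v. f v - g v = h (diff F v))}"

definition Ext_class ::
    "(('x::finite, 'k::field) mpoly \<Rightarrow> 'r::comm_ring_1) \<Rightarrow> ('r, 'b, 'k) free_complex
      \<Rightarrow> (('b \<Rightarrow>\<^sub>0 'r) \<Rightarrow> 'k) \<Rightarrow> (('b \<Rightarrow>\<^sub>0 'r) \<Rightarrow> 'k) set"
  where "Ext_class \<pi> F f = cohomologous \<pi> F `` {f}"

definition Ext ::
    "(('x::finite, 'k::field) mpoly \<Rightarrow> 'r::comm_ring_1) \<Rightarrow> ('r, 'b, 'k) free_complex
      \<Rightarrow> (('b \<Rightarrow>\<^sub>0 'r) \<Rightarrow> 'k) set set"
  where "Ext \<pi> F = cocycles \<pi> F // cohomologous \<pi> F"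

definition Ext_deg ::
    "(('x::finite, 'k::field) mpoly \<Rightarrow> 'r::comm_ring_1) \<Rightarrow> ('r, 'b, 'k) free_complex
      \<Rightarrow> nat \<Rightarrow> (('b \<Rightarrow>\<^sub>0 'r) \<Rightarrow> 'k) set set"
  where "Ext_deg \<pi> F i =
    {Ext_class \<pi> F f | f. f \<in> cocycles \<pi> F \<and> (\<forall>p. p \<noteq> i \<longrightarrow> (\<forall>v \<in> F_term F p. f v = 0))}"

text \<open>
  Liftings of a cocycle \<open>g : F \<rightarrow> k\<close> along the augmentation to a chain map \<open>\<gamma> : F \<rightarrow> F\<close>.  If \<open>g\<close> has
  cohomological degree \<open>j\<close>, this is the usual chain map \<open>F\<^bsub>\<bullet>+j\<^esub> \<rightarrow> F\<^sub>\<bullet>\<close>; since \<open>g\<close> may have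
  components of several degrees, \<open>\<gamma>\<close> is a sum of chain maps lowering the homological degree by
  \<open>0, \<dots>, N\<close>.
\<close>

definition liftings ::
    "('r::comm_ring_1, 'b, 'k::field) free_complex \<Rightarrow> (('b \<Rightarrow>\<^sub>0 'r) \<Rightarrow> 'k)
      \<Rightarrow> (('b \<Rightarrow>\<^sub>0 'r) \<Rightarrow> ('b \<Rightarrow>\<^sub>0 'r)) set"
  where "liftings F g = {\<gamma>. R_endomorphism \<gamma> \<and>
    (\<forall>v. \<gamma> (diff F v) = diff F (\<gamma> v)) \<and> (\<forall>v. augm F (\<gamma> v) = g v) \<and>
    (\<exists>N. \<forall>i. \<forall>v \<in> F_term F i. \<forall>b \<in> Poly_Mapping.keys (\<gamma> v). hdeg F b \<le> i \<and> i \<le> hdeg F b + N)}"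

text \<open>
  The operations of the Yoneda algebra are given on representatives; each union below is over copies of
  one and the same class.  The Yoneda product of the classes of \<open>f\<close> and \<open>g\<close> is the class of \<open>f \<circ> \<gamma>\<close> for
  any lifting \<open>\<gamma>\<close> of \<open>g\<close>.  (Other sign or order conventions change products of homogeneous elements
  by a sign or the algebra to its opposite, hence not the subalgebra generated by homogeneous elements.)
\<close>

definition Ext_one ::
    "(('x::finite, 'k::field) mpoly \<Rightarrow> 'r::comm_ring_1) \<Rightarrow> ('r, 'b, 'k) free_complex
      \<Rightarrow> (('b \<Rightarrow>\<^sub>0 'r) \<Rightarrow> 'k) set"
  where "Ext_one \<pi> F = Ext_class \<pi> F (augm F)"

definition Ext_add ::
    "(('x::finite, 'k::field) mpoly \<Rightarrow> 'r::comm_ring_1) \<Rightarrow> ('r, 'b, 'k) free_complex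
      \<Rightarrow> (('b \<Rightarrow>\<^sub>0 'r) \<Rightarrow> 'k) set \<Rightarrow> (('b \<Rightarrow>\<^sub>0 'r) \<Rightarrow> 'k) set \<Rightarrow> (('b \<Rightarrow>\<^sub>0 'r) \<Rightarrow> 'k) set"
  where "Ext_add \<pi> F X Y = (\<Union>f\<in>X. \<Union>g\<in>Y. Ext_class \<pi> F (\<lambda>v. f v + g v))"

definition Ext_scale ::
    "(('x::finite, 'k::field) mpoly \<Rightarrow> 'r::comm_ring_1) \<Rightarrow> ('r, 'b, 'k) free_complex
      \<Rightarrow> 'k \<Rightarrow> (('b \<Rightarrow>\<^sub>0 'r) \<Rightarrow> 'k) set \<Rightarrow> (('b \<Rightarrow>\<^sub>0 'r) \<Rightarrow> 'k) set"
  where "Ext_scale \<pi> F c X = (\<Union>f\<in>X. Ext_class \<pi> F (\<lambda>v. c * f v))"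

definition Yoneda_mult ::
    "(('x::finite, 'k::field) mpoly \<Rightarrow> 'r::comm_ring_1) \<Rightarrow> ('r, 'b, 'k) free_complex
      \<Rightarrow> (('b \<Rightarrow>\<^sub>0 'r) \<Rightarrow> 'k) set \<Rightarrow> (('b \<Rightarrow>\<^sub>0 'r) \<Rightarrow> 'k) set \<Rightarrow> (('b \<Rightarrow>\<^sub>0 'r) \<Rightarrow> 'k) set"
  where "Yoneda_mult \<pi> F X Y =
    (\<Union>f\<in>X. \<Union>g\<in>Y. \<Union>\<gamma>\<in>liftings F g. Ext_class \<pi> F (f \<circ> \<gamma>))"

inductive_set Yoneda_subalgebra ::
    "(('x::finite, 'k::field) mpoly \<Rightarrow> 'r::comm_ring_1) \<Rightarrow> ('r, 'b, 'k) free_complex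
      \<Rightarrow> (('b \<Rightarrow>\<^sub>0 'r) \<Rightarrow> 'k) set set \<Rightarrow> (('b \<Rightarrow>\<^sub>0 'r) \<Rightarrow> 'k) set set"
  for \<pi> F G
  where
    one: "Ext_one \<pi> F \<in> Yoneda_subalgebra \<pi> F G"
  | gen: "X \<in> G \<Longrightarrow> X \<in> Yoneda_subalgebra \<pi> F G"
  | add: "X \<in> Yoneda_subalgebra \<pi> F G \<Longrightarrow> Y \<in> Yoneda_subalgebra \<pi> F G
      \<Longrightarrow> Ext_add \<pi> F X Y \<in> Yoneda_subalgebra \<pi> F G"
  | scale: "X \<in> Yoneda_subalgebra \<pi> F G \<Longrightarrow> Ext_scale \<pi> F c X \<in> Yoneda_subalgebra \<pi> F G"
  | mult: "X \<in> Yoneda_subalgebra \<pi> F G \<Longrightarrow> Y \<in> Yoneda_subalgebra \<pi> F G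
      \<Longrightarrow> Yoneda_mult \<pi> F X Y \<in> Yoneda_subalgebra \<pi> F G"

end

theory Submission
  imports Defs
begin

text \<open>
  The internal degree of a generator of \<open>Ext\<close> is at most \<open>1\<close> in cohomological degree 1 and at most
  \<open>m = m(I)\<close> in cohomological degree 2, because \<open>Tor\<^sub>1\<close> is spanned by the variables and \<open>Tor\<^sub>2\<close> by the
  Koszul syzygies, of degree \<open>2 \<le> m\<close>, and by the minimal generators of \<open>I\<close>.  Yoneda products add
  internal degrees, so \<open>t\<^sub>i \<le> \<lfloor>i / 2\<rfloor> m + (i mod 2)\<close>; this gives both upper bounds, and the term
  \<open>i = 2\<close>, where \<open>t\<^sub>2 = m\<close>, attains them.  If \<open>m\<close> were infinite, the term \<open>i = 2\<close> alone would suffice,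
  so Hilbert's basis theorem is not needed.

  The resolution \<open>F\<close> is arbitrary, so nothing is minimal: \<open>Tor\<close> is read off from the complex of vector
  spaces \<open>F \<otimes> k\<close>, and degree bounds on classes mean that some representing cocycle vanishes above
  the bound.
\<close>

text \<open>An arbitrary \<open>F\<close> may have terms of infinite rank, so a cocycle may be
  nonzero in infinitely many internal degrees and need not be a sum of bihomogeneous ones. The
  internal grading of Ext is therefore replaced by a one-sided condition, \<open>bounded B\<close>:
  the cocycle vanishes in bidegree \<open>(p, q)\<close> whenever \<open>q > B p\<close>. Sums and
  multiples preserve it. Products preserve it if \<open>B\<close> is superadditive and the lifting
  is chosen so that lowering the homological degree by \<open>s\<close> lowers the internal degree
  by at most \<open>B s\<close>; an arbitrary lifting need not do so, hence the construction in
  \<open>lifting_exists\<close>. Linear duality over \<open>k\<close> translates both ways: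
  vanishing of Tor above a bound lets a generator be corrected by a coboundary, and a nonzero Tor
  class is detected by a cocycle, on whose value there coboundaries have no effect. The shape of the
  bound comes from maximizing \<open>a + b * M\<close> over \<open>a + 2 * b = i\<close>: since
  \<open>M \<ge> 2\<close>, trading two factors of degree 1 for one of degree 2 never decreases
  it.\<close>

abbreviation lookup where "lookup \<equiv> Poly_Mapping.lookup"
abbreviation keys where "keys \<equiv> Poly_Mapping.keys"
abbreviation single where "single \<equiv> Poly_Mapping.single"

section \<open>Finitely supported functions and free modules\<close>

lemma lookup_map [simp]: "f 0 = 0 \<Longrightarrow> lookup (Poly_Mapping.map f v) b = f (lookup v b)"
  by (simp add: Poly_Mapping.map.rep_eq when_def)

lemma sum_single: "finite A \<Longrightarrow> keys p \<subseteq> A \<Longrightarrow> (\<Sum>k\<in>A. single k (lookup p k)) = p"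
  by (rule poly_mapping_eqI) (auto simp: lookup_sum lookup_single when_def in_keys_iff)

lemma poly_mapping_additive_induct [case_names add single]:
  assumes "\<And>p q. P p \<Longrightarrow> P q \<Longrightarrow> P (p + q)" and "\<And>k c. P (single k c)"
  shows "P (p :: 'a \<Rightarrow>\<^sub>0 'c::comm_monoid_add)"
proof -
  have "P (\<Sum>k\<in>A. single k (lookup p k))" if "finite A" for A
    using that
  proof induction
    case empty
    show ?case using assms(2)[of undefined 0] by simp
  qed (use assms in simp)
  then show ?thesis using sum_single[of "keys p" p] by (metis finite_keys order_refl)
qed

section \<open>Restriction of finitely supported functions to a set of indices\<close>

definition prestrict :: "'a set \<Rightarrow> ('a \<Rightarrow>\<^sub>0 'c::zero) \<Rightarrow> 'a \<Rightarrow>\<^sub>0 'c"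
  where "prestrict A = Poly_Mapping.mapp (\<lambda>k c. c when k \<in> A)"

lemma lookup_prestrict [simp]: "lookup (prestrict A p) k = (lookup p k when k \<in> A)"
  by (simp add: prestrict_def lookup_mapp when_def in_keys_iff)

lemma keys_prestrict [simp]: "keys (prestrict A p) = keys p \<inter> A"
  by (auto simp: in_keys_iff)

lemma prestrict_add: "prestrict A (p + q) = prestrict A p + prestrict A (q :: _ \<Rightarrow>\<^sub>0 'c::comm_monoid_add)"
  by (rule poly_mapping_eqI) (simp add: lookup_add when_def)

lemma prestrict_zero [simp]: "prestrict A 0 = 0"
  by (rule poly_mapping_eqI) simp

lemma prestrict_sum: "prestrict A (\<Sum>i\<in>B. f i) = (\<Sum>i\<in>B. prestrict A (f i :: _ \<Rightarrow>\<^sub>0 'c::comm_monoid_add))"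
  by (induction B rule: infinite_finite_induct) (auto simp: prestrict_add)

lemma prestrict_minus: "prestrict A (p - q) = prestrict A p - prestrict A (q :: _ \<Rightarrow>\<^sub>0 'c::ab_group_add)"
  by (rule poly_mapping_eqI) (simp add: lookup_minus when_def)

lemma prestrict_id: "keys p \<subseteq> A \<Longrightarrow> prestrict A p = p"
  by (rule poly_mapping_eqI) (auto simp: when_def in_keys_iff)

lemma prestrict_eq_0: "keys p \<inter> A = {} \<Longrightarrow> prestrict A p = 0"
  by (rule poly_mapping_eqI) (auto simp: when_def in_keys_iff)

lemma prestrict_prestrict: "prestrict A (prestrict B p) = prestrict (A \<inter> B) p"
  by (rule poly_mapping_eqI) (auto simp: when_def)

lemma prestrict_single:
  "prestrict A (single k c) = (if k \<in> A then single k c else 0)"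
  by (rule poly_mapping_eqI) (auto simp: when_def lookup_single)

section \<open>Free modules and linear extension from a basis\<close>

lemma lookup_free_scale [simp]: "lookup (free_scale r v) b = r * lookup v b"
  by (simp add: free_scale_def)

lemma module_free_scale: "module (free_scale :: 'r::comm_ring_1 \<Rightarrow> ('b \<Rightarrow>\<^sub>0 'r) \<Rightarrow> _)"
  by unfold_locales (auto intro!: poly_mapping_eqI simp: lookup_add algebra_simps)

lemma free_scale_single: "free_scale r (single b s) = single b (r * s)"
  by (rule poly_mapping_eqI) (simp add: lookup_single when_def)

lemma module_mult: "module ((*) :: 'r::comm_ring_1 \<Rightarrow> 'r \<Rightarrow> 'r)"
  by unfold_locales (auto simp: algebra_simps)

interpretation free: module free_scale
  by (rule module_free_scale)

interpretation rmod: module "(*) :: 'r::comm_ring_1 \<Rightarrow> 'r \<Rightarrow> 'r"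
  by (rule module_mult)

text \<open>For the ring acting on itself this rule is associativity read from right to left, which
  clashes with \<open>mult.assoc\<close> and \<open>algebra_simps\<close>.\<close>

declare rmod.scale_scale [simp del]

definition lin :: "('r::comm_ring_1 \<Rightarrow> 'm \<Rightarrow> 'm::ab_group_add) \<Rightarrow> ('b \<Rightarrow> 'm) \<Rightarrow> ('b \<Rightarrow>\<^sub>0 'r) \<Rightarrow> 'm"
  where "lin scl \<phi> v = (\<Sum>b\<in>keys v. scl (lookup v b) (\<phi> b))"

context module
begin

lemma lin_superset:
  assumes "finite A" "keys v \<subseteq> A"
  shows "lin scale \<phi> v = (\<Sum>b\<in>A. scale (lookup v b) (\<phi> b))"
  unfolding lin_def by (rule sum.mono_neutral_left) (use assms in \<open>auto simp: in_keys_iff\<close>)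

lemma module_hom_lin: "module_hom free_scale scale (lin scale \<phi>)"
proof
  fix v w :: "'c \<Rightarrow>\<^sub>0 'a" and r
  let ?A = "keys v \<union> keys w"
  show "lin scale \<phi> (v + w) = lin scale \<phi> v + lin scale \<phi> w"
    using keys_add[of v w]
    by (simp add: lin_superset[of ?A] lookup_add scale_left_distrib sum.distrib)
  have "keys (free_scale r v) \<subseteq> keys v"
    by (auto simp: in_keys_iff)
  then show "lin scale \<phi> (free_scale r v) = scale r (lin scale \<phi> v)"
    by (simp add: lin_superset[of "keys v"] scale_sum_right)
qed

lemma lin_single [simp]: "lin scale \<phi> (single b r) = scale r (\<phi> b)"
  by (cases "r = 0") (simp_all add: lin_def)

lemma hom_single:
  assumes "module_hom free_scale scale f"
  shows "f (single b r) = scale r (f (single b 1))"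
  using module_hom.scale[OF assms, of r "single b 1"] by (simp add: free_scale_single)

lemma hom_eq_lin:
  assumes "module_hom free_scale scale f"
  shows "f v = lin scale (\<lambda>b. f (single b 1)) v"
proof (induction v rule: poly_mapping_additive_induct)
  case (add p q)
  then show ?case by (simp add: module_hom.add[OF assms] module_hom.add[OF module_hom_lin])
qed (simp add: hom_single[OF assms, symmetric])

lemma hom_eqI:
  assumes "module_hom free_scale scale f" "module_hom free_scale scale g"
    and "\<And>b. b \<in> keys v \<Longrightarrow> f (single b 1) = g (single b 1)"
  shows "f v = g v"
  unfolding hom_eq_lin[OF assms(1), of v] hom_eq_lin[OF assms(2), of v]
  by (simp add: lin_def assms(3))

end

section \<open>Linear algebra over a field\<close>

lemma vector_space_free_scale: "vector_space (free_scale :: 'k::field \<Rightarrow> ('b \<Rightarrow>\<^sub>0 'k) \<Rightarrow> _)"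
  by unfold_locales (auto intro!: poly_mapping_eqI simp: lookup_add algebra_simps)

lemma vector_space_mult: "vector_space ((*) :: 'k::field \<Rightarrow> 'k \<Rightarrow> 'k)"
  by unfold_locales (auto simp: algebra_simps)

text \<open>A basis of the range of \<open>D\<close> stays independent when \<open>x\<close> is
  added, so a linear map can be prescribed as 0 on that basis and 1 at \<open>x\<close>. Applied to
  the differential of \<open>F \<otimes> k\<close>, it detects a nonzero Tor class.\<close>

lemma separating_functional:
  fixes D :: "('b \<Rightarrow>\<^sub>0 'k::field) \<Rightarrow> ('b \<Rightarrow>\<^sub>0 'k)"
  assumes D: "module_hom free_scale free_scale D" and x: "x \<notin> range D"
  shows "\<exists>\<phi>. module_hom free_scale (*) \<phi> \<and> (\<forall>y. \<phi> (D y) = 0) \<and> \<phi> x = 1"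
proof -
  have sub: "free.subspace (range D)"
    by (rule module_hom.subspace_image[OF D free.subspace_UNIV])
  obtain B where B: "B \<subseteq> range D" "free.independent B" "range D \<subseteq> free.span B"
    by (rule vector_space.maximal_independent_subset[OF vector_space_free_scale])
  have span: "free.span B = range D"
    using B(3) free.span_minimal[OF B(1) sub] by (rule equalityI[rotated])
  with x have x': "x \<notin> free.span B" by simp
  then have ind: "free.independent (insert x B)"
    by (intro B(2) vector_space.independent_insertI[OF vector_space_free_scale] x')
  obtain \<phi> where \<phi>: "Vector_Spaces.linear free_scale (*) \<phi>"
    "\<forall>b\<in>insert x B. \<phi> b = (if b = x then 1 else 0)"
    using vector_space_pair.linear_independent_extend[OF
        vector_space_pair.intro[OF vector_space_free_scale vector_space_mult] ind,
        of "\<lambda>b. if b = x then 1 else 0"]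
    by (elim exE conjE)
  have hom: "module_hom free_scale (*) \<phi>"
    by (fact \<phi>(1)[folded module_hom_eq_linear])
  have xB: "x \<notin> B"
    using x' free.span_base by blast
  have "\<phi> b = 0" if "b \<in> B" for b
    using \<phi>(2) xB that by auto
  then have "\<phi> (D y) = 0" for y
    using module_hom.eq_0_on_span[OF hom, of B "D y"] span by simp
  moreover have "\<phi> x = 1"
    using \<phi>(2) by simp
  ultimately show ?thesis
    using hom by blast
qed

text \<open>Compose \<open>\<psi>\<close> with a linear right inverse of \<open>D\<close> on its
  range; two preimages of one element differ by a kernel element, which \<open>\<psi>\<close>
  ignores. This produces cochains with prescribed coboundary.\<close>

lemma factor_functional:
  fixes D :: "('b \<Rightarrow>\<^sub>0 'k::field) \<Rightarrow> ('b \<Rightarrow>\<^sub>0 'k)"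
  assumes D: "module_hom free_scale free_scale D" and \<psi>: "module_hom free_scale (*) \<psi>"
    and ker: "\<And>x. D x = 0 \<Longrightarrow> \<psi> x = 0"
  shows "\<exists>h. module_hom free_scale (*) h \<and> (\<forall>x. h (D x) = \<psi> x)"
proof -
  obtain g where g: "Vector_Spaces.linear free_scale free_scale g" "\<forall>v\<in>range D. D (g v) = v"
    using vector_space_pair.linear_exists_right_inverse_on[OF
        vector_space_pair.intro[OF vector_space_free_scale vector_space_free_scale]
        D[unfolded module_hom_eq_linear] free.subspace_UNIV]
    by (elim exE conjE)
  have "\<psi> (g (D x)) = \<psi> x" for x
  proof -
    have "D (g (D x) - x) = 0"
      using g(2) by (simp add: module_hom.diff[OF D])
    from ker[OF this] show ?thesis
      by (simp add: module_hom.diff[OF \<psi>])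
  qed
  moreover have "module_hom free_scale (*) (\<psi> \<circ> g)"
    by (rule module_hom_compose[OF _ \<psi>]) (fact g(1)[folded module_hom_eq_linear])
  ultimately show ?thesis
    by (intro exI[of _ "\<psi> \<circ> g"]) simp
qed

section \<open>Homogeneous components of polynomials\<close>

definition mdeg :: "('x::finite \<Rightarrow>\<^sub>0 nat) \<Rightarrow> nat"
  where "mdeg m = (\<Sum>i\<in>UNIV. lookup m i)"

lemma mdeg_add [simp]: "mdeg (m + m') = mdeg m + mdeg m'"
  by (simp add: mdeg_def lookup_add sum.distrib)

lemma mdeg_zero [simp]: "mdeg 0 = 0"
  by (simp add: mdeg_def)

lemma mdeg_single [simp]: "mdeg (single i k) = k"
  by (simp add: mdeg_def lookup_single when_def)

lemma mdeg_eq_0_iff [simp]: "mdeg m = 0 \<longleftrightarrow> m = 0"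
  by (auto simp: mdeg_def intro!: poly_mapping_eqI)

lemma homogeneous_iff: "homogeneous e p \<longleftrightarrow> (\<forall>m\<in>keys p. mdeg m = e)"
  by (simp add: homogeneous_def mdeg_def)

lemma monomial_split:
  fixes m :: "'x \<Rightarrow>\<^sub>0 nat"
  assumes "lookup m i > 0"
  obtains m' where "m = single i 1 + m'"
proof
  show "m = single i 1 + (m - single i 1)"
    by (rule poly_mapping_eqI) (use assms in \<open>auto simp: lookup_add lookup_minus lookup_single when_def\<close>)
qed

lemma monomial_nonzero_split:
  assumes "m \<noteq> 0"
  obtains i m' where "m = single i (1::nat) + m'"
proof -
  from assms obtain i where "lookup m i \<noteq> 0"
    by (metis poly_mapping_eqI lookup_zero)
  then show ?thesis using monomial_split[of m i] that by blast
qed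

lemma homogeneous_zero [simp]: "homogeneous e 0"
  by (simp add: homogeneous_iff)

lemma homogeneous_add: "homogeneous e p \<Longrightarrow> homogeneous e q \<Longrightarrow> homogeneous e (p + q)"
  using keys_add[of p q] by (auto simp: homogeneous_iff)

lemma homogeneous_minus: "homogeneous e p \<Longrightarrow> homogeneous e q \<Longrightarrow> homogeneous e (p - q)"
  using keys_diff[of p q] by (auto simp: homogeneous_iff)

lemma homogeneous_sum: "(\<And>i. i \<in> A \<Longrightarrow> homogeneous e (f i)) \<Longrightarrow> homogeneous e (\<Sum>i\<in>A. f i)"
  by (induction A rule: infinite_finite_induct) (auto simp: homogeneous_add)

lemma homogeneous_mult: "homogeneous d p \<Longrightarrow> homogeneous e q \<Longrightarrow> homogeneous (d + e) (p * q)"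
  using keys_mult[of p q] by (fastforce simp: homogeneous_iff)

lemma homogeneous_single [simp]: "homogeneous (mdeg m) (single m c)"
  by (simp add: homogeneous_iff)

lemma homogeneous_mvar [simp]: "homogeneous 1 (mvar i)"
  by (simp add: homogeneous_iff mvar_def)

lemma mvar_mult_single: "mvar i * single m c = single (single i 1 + m) c"
  by (simp add: mvar_def mult_single)

abbreviation hproj :: "nat set \<Rightarrow> ('x::finite, 'k::field) mpoly \<Rightarrow> ('x, 'k) mpoly"
  where "hproj E \<equiv> prestrict {m. mdeg m \<in> E}"

lemma homogeneous_hproj [simp]: "homogeneous e (hproj {e} p)"
  by (simp add: homogeneous_iff)

lemma hproj_homogeneous: "homogeneous d p \<Longrightarrow> hproj E p = (if d \<in> E then p else 0)"
  by (auto simp: homogeneous_iff intro: prestrict_id prestrict_eq_0)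

lemma hcomp_homogeneous: "homogeneous d p \<Longrightarrow> prestrict {m. mdeg m = e} p = (if d = e then p else 0)"
  using hproj_homogeneous[of d p "{e}"] by simp

text \<open>Multiplication by a homogeneous element shifts degrees. Projecting to a set of degrees
  expresses the shift as a preimage, which avoids truncated subtraction when \<open>d\<close>
  exceeds the target degree.\<close>

lemma hproj_mult:
  assumes "homogeneous d a"
  shows "hproj E (a * p) = a * hproj {e. d + e \<in> E} p"
proof -
  let ?E = "{e. d + e \<in> E}"
  have "p = hproj ?E p + hproj (- ?E) p"
    by (rule poly_mapping_eqI) (simp add: lookup_add when_def)
  from arg_cong[OF this, of "\<lambda>p. hproj E (a * p)"]
  have "hproj E (a * p) = hproj E (a * hproj ?E p) + hproj E (a * hproj (- ?E) p)"
    by (simp only: distrib_left prestrict_add)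
  moreover have "hproj E (a * hproj ?E p) = a * hproj ?E p"
    using keys_mult[of a "hproj ?E p"] assms
    by (intro prestrict_id) (fastforce simp: homogeneous_iff)
  moreover have "hproj E (a * hproj (- ?E) p) = 0"
    using keys_mult[of a "hproj (- ?E) p"] assms
    by (intro prestrict_eq_0) (fastforce simp: homogeneous_iff)
  ultimately show ?thesis by simp
qed

lemma hproj_mvar_mult:
  "hproj {e} (mvar i * p) = (case e of 0 \<Rightarrow> 0 | Suc e' \<Rightarrow> mvar i * hproj {e'} p)"
  using hproj_mult[OF homogeneous_mvar, of "{e}" i p]
  by (cases e) (simp_all add: prestrict_eq_0)

lemma lookup_mult_zero:
  fixes p q :: "('x, 'k::field) mpoly"
  shows "lookup (p * q) 0 = lookup p 0 * lookup q 0"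
proof (induction p rule: poly_mapping_additive_induct)
  case (single m c)
  show ?case
  proof (induction q rule: poly_mapping_additive_induct)
    case (single m' d)
    have "m + m' = 0 \<longleftrightarrow> m = 0 \<and> m' = 0"
      by (auto simp: poly_mapping_eq_iff fun_eq_iff lookup_add)
    then show ?case
      by (auto simp: mult_single lookup_single when_def)
  qed (simp add: distrib_left lookup_add)
qed (simp add: distrib_right lookup_add)

lemma homogeneous_lookup_zero: "homogeneous e p \<Longrightarrow> e \<noteq> 0 \<Longrightarrow> lookup p 0 = 0"
  by (metis homogeneous_iff in_keys_iff mdeg_zero)

lemma homogeneous_0_eq: "homogeneous 0 p \<Longrightarrow> p = single 0 (lookup p 0)"
  by (rule poly_mapping_eqI) (auto simp: homogeneous_iff in_keys_iff lookup_single when_def)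

text \<open>Every monomial is nonconstant and is assigned to one variable dividing it, so the
  cofactors of a homogeneous \<open>p\<close> are homogeneous.\<close>

lemma irrelevant_expansion:
  fixes p :: "('x::finite, 'k::field) mpoly"
  assumes "lookup p 0 = 0"
  obtains q where "p = (\<Sum>i\<in>UNIV. mvar i * q i)"
    and "\<And>e i. homogeneous (Suc e) p \<Longrightarrow> homogeneous e (q i)"
proof -
  have "\<exists>i m'. m = single i 1 + m'" if "m \<in> keys p" for m
    using that assms monomial_nonzero_split[of m] by (metis in_keys_iff)
  then obtain t r where tr: "\<And>m. m \<in> keys p \<Longrightarrow> m = single (t m) 1 + r m"
    by metis
  define q where "q = (\<lambda>i. \<Sum>m\<in>{m \<in> keys p. t m = i}. single (r m) (lookup p m))"
  have "(\<Sum>i\<in>UNIV. mvar i * q i) = (\<Sum>i\<in>UNIV. \<Sum>m\<in>{m \<in> keys p. t m = i}. single m (lookup p m))"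
    unfolding q_def sum_distrib_left mvar_mult_single
    by (intro sum.cong refl) (metis (mono_tags, lifting) mem_Collect_eq tr)
  also have "\<dots> = (\<Sum>m\<in>keys p. single m (lookup p m))"
    by (rule sum.group) auto
  finally have "p = (\<Sum>i\<in>UNIV. mvar i * q i)"
    by (simp add: sum_single)
  moreover have "homogeneous e (q i)" if "homogeneous (Suc e) p" for e i
    unfolding q_def
  proof (rule homogeneous_sum)
    fix m assume "m \<in> {m \<in> keys p. t m = i}"
    with that tr have "Suc e = mdeg (single (t m) 1 + r m)"
      by (metis (mono_tags, lifting) homogeneous_iff mem_Collect_eq)
    then show "homogeneous e (single (r m) (lookup p m))"
      by (simp add: homogeneous_iff)
  qed
  ultimately show thesis
    by (rule that)
qed

section \<open>Homogeneous ideals\<close>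

lemma ideal_mult: "rmod.subspace J \<Longrightarrow> q \<in> J \<Longrightarrow> p * q \<in> J"
  by (rule rmod.subspace_scale)

text \<open>The polynomials all of whose projections lie in the ideal form an ideal themselves: the
  multiplier may be taken to be a monomial, which only shifts the set of degrees.\<close>

lemma hproj_ideal_gen:
  assumes "\<forall>g\<in>G. \<exists>e. homogeneous e g" and "p \<in> ideal_gen G"
  shows "hproj E p \<in> ideal_gen G"
proof -
  let ?T = "{p. \<forall>E. hproj E p \<in> ideal_gen G}"
  have "hproj E (a * p) \<in> ideal_gen G" if "p \<in> ?T" for a p E
  proof (induction a rule: poly_mapping_additive_induct)
    case (single m c)
    have "single m c * hproj {e. mdeg m + e \<in> E} p \<in> ideal_gen G"
      using that by (intro rmod.span_scale) blast
    then show ?case by (simp add: hproj_mult[of "mdeg m"])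
  qed (simp add: distrib_right prestrict_add rmod.span_add)
  then have "rmod.subspace ?T"
    by (auto simp: rmod.subspace_def prestrict_add intro: rmod.span_zero rmod.span_add)
  moreover have "G \<subseteq> ?T"
    using assms(1) by (auto simp: hproj_homogeneous rmod.span_base rmod.span_zero)
  ultimately show ?thesis
    using rmod.span_minimal[of G ?T] assms(2) by blast
qed

lemma subspace_order_ge: "rmod.subspace {p :: ('x::finite, 'k::field) mpoly. \<forall>m\<in>keys p. d \<le> mdeg m}"
proof (rule rmod.subspaceI)
  fix p q :: "('x, 'k) mpoly"
  assume "p \<in> {p. \<forall>m\<in>keys p. d \<le> mdeg m}" "q \<in> {p. \<forall>m\<in>keys p. d \<le> mdeg m}"
  then show "p + q \<in> {p. \<forall>m\<in>keys p. d \<le> mdeg m}"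
    using keys_add[of p q] by auto
next
  fix c p :: "('x, 'k) mpoly"
  assume "p \<in> {p. \<forall>m\<in>keys p. d \<le> mdeg m}"
  then show "c * p \<in> {p. \<forall>m\<in>keys p. d \<le> mdeg m}"
    using keys_mult[of c p] by fastforce
qed simp

lemma irrelevant_ideal_order: "p \<in> irrelevant_ideal \<Longrightarrow> m \<in> keys p \<Longrightarrow> 1 \<le> mdeg m"
proof -
  have "mvar ` UNIV \<subseteq> {p :: ('x::finite, 'k::field) mpoly. \<forall>m\<in>keys p. 1 \<le> mdeg m}"
    by (auto simp: mvar_def)
  from rmod.span_minimal[OF this subspace_order_ge]
  show "p \<in> irrelevant_ideal \<Longrightarrow> m \<in> keys p \<Longrightarrow> 1 \<le> mdeg m"
    unfolding irrelevant_ideal_def by blast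
qed

lemma irrelevant_ideal_sq_order: "p \<in> irrelevant_ideal_sq \<Longrightarrow> m \<in> keys p \<Longrightarrow> 2 \<le> mdeg m"
proof -
  have "2 \<le> mdeg m" if "a \<in> irrelevant_ideal" "b \<in> irrelevant_ideal" "m \<in> keys (a * b)" for a b m
    using keys_mult[of a b] that irrelevant_ideal_order[of a] irrelevant_ideal_order[of b] by fastforce
  then have "{a * b |a b. a \<in> irrelevant_ideal \<and> b \<in> irrelevant_ideal} \<subseteq> {p. \<forall>m\<in>keys p. 2 \<le> mdeg m}"
    by blast
  from rmod.span_minimal[OF this subspace_order_ge]
  show "p \<in> irrelevant_ideal_sq \<Longrightarrow> m \<in> keys p \<Longrightarrow> 2 \<le> mdeg m"
    unfolding irrelevant_ideal_sq_def by blast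
qed

text \<open>For an ideal \<open>I\<close> this is its product with the irrelevant ideal; keeping one
  cofactor per variable makes degree arguments direct.\<close>

definition irrelevant_times :: "('x::finite, 'k::field) mpoly set \<Rightarrow> ('x, 'k) mpoly set"
  where "irrelevant_times I = {\<Sum>i\<in>UNIV. mvar i * q i | q. \<forall>i. q i \<in> I}"

locale graded_ideal =
  fixes I :: "('x::finite, 'k::field) mpoly set"
  assumes homogeneous_ideal: "homogeneous_ideal I"
begin

abbreviation mI where "mI \<equiv> irrelevant_times I"

lemma subspace_I: "rmod.subspace I"
  using homogeneous_ideal by (auto simp: homogeneous_ideal_def)

lemma hproj_I: "p \<in> I \<Longrightarrow> hproj E p \<in> I"
  using homogeneous_ideal hproj_ideal_gen by (auto simp: homogeneous_ideal_def)

lemma subspace_mI: "rmod.subspace mI"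
proof (rule rmod.subspaceI)
  show "0 \<in> mI"
    using rmod.subspace_0[OF subspace_I] unfolding irrelevant_times_def
    by (intro CollectI exI[of _ "\<lambda>_. 0"]) simp
next
  fix p q assume "p \<in> mI" "q \<in> mI"
  then obtain a b where "p = (\<Sum>i\<in>UNIV. mvar i * a i)" "\<forall>i. a i \<in> I"
    "q = (\<Sum>i\<in>UNIV. mvar i * b i)" "\<forall>i. b i \<in> I"
    by (auto simp: irrelevant_times_def)
  then show "p + q \<in> mI"
    unfolding irrelevant_times_def
    by (intro CollectI exI[of _ "\<lambda>i. a i + b i"])
      (simp add: sum.distrib distrib_left rmod.subspace_add[OF subspace_I])
next
  fix c p assume "p \<in> mI"
  then obtain a where "p = (\<Sum>i\<in>UNIV. mvar i * a i)" "\<forall>i. a i \<in> I"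
    by (auto simp: irrelevant_times_def)
  then show "c * p \<in> mI"
    unfolding irrelevant_times_def
    by (intro CollectI exI[of _ "\<lambda>i. c * a i"])
      (simp add: sum_distrib_left mult.left_commute ideal_mult[OF subspace_I])
qed

lemma mult_mI:
  assumes "lookup p 0 = 0" "q \<in> I"
  shows "p * q \<in> mI"
proof -
  from assms(1) obtain r where "p = (\<Sum>i\<in>UNIV. mvar i * r i)"
    by (rule irrelevant_expansion)
  then show ?thesis
    unfolding irrelevant_times_def
    by (intro CollectI exI[of _ "\<lambda>i. r i * q"])
      (simp add: sum_distrib_right mult.assoc ideal_mult[OF subspace_I] assms(2))
qed

text \<open>Nakayama in the degree of \<open>g\<close>: modulo the ideal \<open>?J\<close> of the
  other generators each cofactor is a multiple of \<open>g\<close>, so \<open>g = g * a + j\<close>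
  where \<open>a\<close> has no constant term. Then \<open>g * a\<close> has nothing in degree
  \<open>e\<close>, so \<open>g\<close> is the degree \<open>e\<close> part of \<open>j\<close> and
  was redundant.\<close>

lemma minimal_generator_not_mI:
  assumes G: "minimal_generators I G" and g: "g \<in> G"
  shows "g \<notin> mI"
proof
  assume "g \<in> mI"
  then obtain q where q: "g = (\<Sum>i\<in>UNIV. mvar i * q i)" "\<forall>i. q i \<in> I"
    by (auto simp: irrelevant_times_def)
  let ?J = "ideal_gen (G - {g})"
  have hom: "\<forall>g\<in>G. \<exists>e. homogeneous e g" and I: "ideal_gen G = I"
    using G by (auto simp: minimal_generators_def)
  obtain e where e: "homogeneous e g" using hom g by blast
  have "\<exists>c. q i - c * g \<in> ?J" for i
  proof -
    have "q i \<in> ideal_gen (insert g (G - {g}))"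
      using q(2) I g by (simp add: insert_absorb)
    then show ?thesis by (simp only: rmod.span_breakdown_eq)
  qed
  then obtain c where c: "\<And>i. q i - c i * g \<in> ?J" by metis
  define a where "a = (\<Sum>i\<in>UNIV. mvar i * c i)"
  define j where "j = (\<Sum>i\<in>UNIV. mvar i * (q i - c i * g))"
  have "j \<in> ?J"
    unfolding j_def by (intro rmod.span_sum rmod.span_scale c)
  have "g = g * a + j"
    unfolding a_def j_def by (subst q(1))
      (simp add: right_diff_distrib sum_subtractf sum_distrib_left mult.commute mult.left_commute)
  then have "hproj {e} g = hproj {e} (g * a) + hproj {e} j"
    by (metis prestrict_add)
  moreover have "hproj {f. e + f \<in> {e}} a = 0"
  proof (rule prestrict_eq_0)
    have "lookup a 0 = 0"
      by (simp add: a_def lookup_sum lookup_mult_zero homogeneous_lookup_zero[OF homogeneous_mvar])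
    then show "keys a \<inter> {m. mdeg m \<in> {f. e + f \<in> {e}}} = {}"
      by (auto simp: in_keys_iff)
  qed
  ultimately have "g = hproj {e} j"
    using hproj_mult[OF e, of "{e}" a] hproj_homogeneous[OF e, of "{e}"] by simp
  then have "g \<in> ?J"
    using hproj_ideal_gen[of "G - {g}" j "{e}"] hom \<open>j \<in> ?J\<close> by simp
  then have "G \<subseteq> ?J"
    using rmod.span_superset[of "G - {g}"] by blast
  then have "ideal_gen G = ?J"
    using rmod.span_mono[of "G - {g}" G] rmod.span_minimal[of G ?J] by auto
  then show False
    using G g by (auto simp: minimal_generators_def)
qed

text \<open>Homogeneous representatives of a basis of the vector space \<open>I / mI\<close> will
  do: they generate by induction on the degree, and none can be omitted because they are independent
  modulo \<open>mI\<close>.\<close>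

lemma minimal_generators_exist: "\<exists>G. minimal_generators I G"
proof -
  define H where "H = {h \<in> I. \<exists>e. homogeneous e h}"
  have fs: "free_scale c p = single 0 c * p" for c and p :: "('x, 'k) mpoly"
    unfolding free_scale_def by (rule mult_map_scale_conv_mult)
  have sub: "free.subspace J" if "rmod.subspace J" for J :: "('x, 'k) mpoly set"
    using that unfolding rmod.subspace_def free.subspace_def fs by auto
  \<comment> \<open>A basis \<open>B0\<close> of \<open>mI\<close> is extended by homogeneous
    elements of \<open>I\<close>; the added elements \<open>G\<close> are the
    representatives.\<close>
  obtain B0 where B0: "B0 \<subseteq> mI" "free.independent B0" "mI \<subseteq> free.span B0"
    by (rule vector_space.maximal_independent_subset[OF vector_space_free_scale])
  then have span_B0: "free.span B0 = mI"
    using free.span_minimal[OF B0(1) sub[OF subspace_mI]] by blast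
  obtain B where B: "B0 \<subseteq> B" "B \<subseteq> B0 \<union> H" "free.independent B" "B0 \<union> H \<subseteq> free.span B"
    by (rule vector_space.maximal_independent_subset_extend
        [OF vector_space_free_scale, of B0 "B0 \<union> H"]) (use B0 in auto)
  define G where "G = B - B0"
  have G_H: "G \<subseteq> H" using B(2) by (auto simp: G_def)
  then have hom: "\<forall>g\<in>G. \<exists>e. homogeneous e g" by (auto simp: H_def)
  have B_eq: "B = B0 \<union> G" using B(1) by (auto simp: G_def)
  have GI: "ideal_gen G \<subseteq> I"
    using G_H by (intro rmod.span_minimal subspace_I) (auto simp: H_def)
  have gen: "f \<in> ideal_gen G" if "f \<in> I" "homogeneous e f" for e f
    using that
  proof (induction e arbitrary: f rule: less_induct)
    case (less e)
    have "f \<in> free.span (B0 \<union> G)"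
      using less.prems B(4) B_eq by (auto simp: H_def)
    then obtain a b where f: "f = a + b" "a \<in> mI" "b \<in> free.span G"
      by (auto simp: free.span_Un span_B0)
    have "b \<in> ideal_gen G"
      using f(3) free.span_minimal[OF rmod.span_superset sub[OF rmod.subspace_span]] by blast
    then have b: "hproj {e} b \<in> ideal_gen G"
      using hom hproj_ideal_gen by blast
    from f(2) obtain q where q: "a = (\<Sum>i\<in>UNIV. mvar i * q i)" "\<forall>i. q i \<in> I"
      by (auto simp: irrelevant_times_def)
    \<comment> \<open>Here the induction applies: the cofactor of \<open>mvar i\<close> matters only
      in degree \<open>e - 1\<close>, and that component lies in \<open>I\<close>.\<close>
    have "hproj {e} (mvar i * q i) \<in> ideal_gen G" for i
    proof (cases e)
      case (Suc e')
      have "hproj {e'} (q i) \<in> I"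
        using q(2) by (intro hproj_I) simp
      then have "mvar i * hproj {e'} (q i) \<in> ideal_gen G"
        using less.IH[of e' "hproj {e'} (q i)"] homogeneous_hproj[of e' "q i"] Suc by (intro rmod.span_scale) simp
      then show ?thesis
        unfolding hproj_mvar_mult Suc by (simp only: nat.case)
    qed (use rmod.span_zero in \<open>simp only: hproj_mvar_mult nat.case\<close>)
    then have "hproj {e} a \<in> ideal_gen G"
      unfolding q(1) prestrict_sum by (intro rmod.span_sum)
    then have "hproj {e} f \<in> ideal_gen G"
      unfolding f(1) prestrict_add using b by (intro rmod.span_add)
    then show ?case
      using less.prems(2) by (simp add: hcomp_homogeneous)
  qed
  have "I \<subseteq> ideal_gen G"
  proof -
    obtain G0 where G0: "\<forall>g\<in>G0. \<exists>e. homogeneous e g" "I = ideal_gen G0"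
      using homogeneous_ideal by (auto simp: homogeneous_ideal_def)
    then have "G0 \<subseteq> ideal_gen G"
      using gen rmod.span_superset[of G0] by blast
    then show ?thesis
      unfolding G0(2) by (rule rmod.span_minimal) simp
  qed
  moreover have "ideal_gen H' \<noteq> I" if "H' \<subset> G" for H'
  proof
    assume I: "ideal_gen H' = I"
    from that obtain g where g: "g \<in> G" "g \<notin> H'" by blast
    let ?T = "{f \<in> I. f \<in> free.span (H' \<union> B0)}"
    have mI_span: "p \<in> free.span (H' \<union> B0)" if "p \<in> mI" for p
      using that span_B0 free.span_mono[of B0 "H' \<union> B0"] by blast
    \<comment> \<open>Modulo \<open>mI\<close> a polynomial acts on \<open>I\<close> through its
      constant term, so a vector subspace of \<open>I\<close> containing \<open>mI\<close> is an
      ideal.\<close>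
    have "rmod.subspace ?T"
    proof (rule rmod.subspaceI)
      fix c f assume f: "f \<in> ?T"
      have "(c - single 0 (lookup c 0)) * f \<in> mI"
        using f by (intro mult_mI) (auto simp: lookup_minus)
      moreover have "free_scale (lookup c 0) f \<in> free.span (H' \<union> B0)"
        using f by (auto intro: free.span_scale)
      ultimately have "(c - single 0 (lookup c 0)) * f + single 0 (lookup c 0) * f \<in> free.span (H' \<union> B0)"
        by (intro free.span_add) (simp_all add: mI_span fs)
      then show "c * f \<in> ?T"
        using f ideal_mult[OF subspace_I] by (auto simp: left_diff_distrib)
    qed (auto simp: rmod.subspace_0[OF subspace_I] rmod.subspace_add[OF subspace_I]
          intro: free.span_zero free.span_add)
    moreover have "H' \<subseteq> ?T"
      using that G_H by (auto simp: H_def intro: free.span_base)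
    ultimately have "I \<subseteq> ?T"
      using rmod.span_minimal[of H' ?T] I by blast
    then have "g \<in> free.span (H' \<union> B0)"
      using g(1) G_H by (auto simp: H_def)
    moreover have "H' \<union> B0 \<subseteq> B - {g}"
      using that g B(1) by (auto simp: G_def)
    ultimately have "g \<in> free.span (B - {g})"
      using free.span_mono by blast
    then show False
      using B(3) g(1) by (auto simp: vector_space.dependent_def[OF vector_space_free_scale] G_def)
  qed
  ultimately show ?thesis
    using GI hom unfolding minimal_generators_def by blast
qed

text \<open>Elements of \<open>I\<close> whose degree \<open>j\<close> part lies in
  \<open>mI\<close> form an ideal: constants preserve \<open>mI\<close>, and a nonconstant monomial
  carries all of \<open>I\<close> into \<open>mI\<close>. The generators belong to it because they
  have no degree \<open>j\<close> part.\<close>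

lemma high_degree_mI:
  assumes G: "minimal_generators I G" and "\<And>g e. g \<in> G \<Longrightarrow> g \<noteq> 0 \<Longrightarrow> homogeneous e g \<Longrightarrow> e \<noteq> j"
    and f: "f \<in> I" "homogeneous j f"
  shows "f \<in> mI"
proof -
  let ?T = "{f \<in> I. hproj {j} f \<in> mI}"
  have "hproj {j} (c * f) \<in> mI" if f: "f \<in> ?T" for c f
  proof (induction c rule: poly_mapping_additive_induct)
    case (single m c)
    show ?case
    proof (cases "m = 0")
      case True
      then show ?thesis
        using f ideal_mult[OF subspace_mI, of "hproj {j} f" "single 0 c"]
          hproj_mult[of 0 "single 0 c" "{j}" f] by (simp add: homogeneous_iff)
    next
      case False
      then have "single m c * hproj {e. mdeg m + e \<in> {j}} f \<in> mI"
        using f by (intro mult_mI hproj_I) (auto simp: lookup_single)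
      then show ?thesis
        by (simp only: hproj_mult[OF homogeneous_single])
    qed
  qed (simp add: distrib_right prestrict_add rmod.subspace_add[OF subspace_mI])
  then have "rmod.subspace ?T"
    by (intro rmod.subspaceI) (auto simp: prestrict_add rmod.subspace_0[OF subspace_I]
        rmod.subspace_0[OF subspace_mI] rmod.subspace_add[OF subspace_I]
        rmod.subspace_add[OF subspace_mI] ideal_mult[OF subspace_I])
  moreover have "G \<subseteq> ?T"
  proof
    fix g assume g: "g \<in> G"
    then obtain e where e: "homogeneous e g" "g \<in> I"
      using G rmod.span_base[of g G] by (auto simp: minimal_generators_def)
    then have "hproj {j} g = 0"
      using assms(2)[OF g _ e(1)] by (cases "g = 0") (simp_all add: hcomp_homogeneous[OF e(1)])
    with e show "g \<in> ?T"
      by (simp add: rmod.subspace_0[OF subspace_mI])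
  qed
  ultimately have "I \<subseteq> ?T"
    using rmod.span_minimal[of G ?T] G by (auto simp: minimal_generators_def)
  then show ?thesis
    using f by (auto simp: hcomp_homogeneous)
qed

end

section \<open>Linear syzygies of the variables\<close>

text \<open>The irrelevant ideal times the syzygy module of the variables: every \<open>z l\<close>
  is a syzygy, and \<open>s\<close> combines them with the variables as coefficients.\<close>

definition m_syzygy :: "('x::finite \<Rightarrow> ('x, 'k::field) mpoly) \<Rightarrow> bool"
  where "m_syzygy s \<longleftrightarrow> (\<exists>z. (\<forall>l. (\<Sum>i\<in>UNIV. mvar i * z l i) = 0) \<and> (\<forall>i. s i = (\<Sum>l\<in>UNIV. mvar l * z l i)))"

lemma m_syzygy_zero: "m_syzygy (\<lambda>i. 0)"
  unfolding m_syzygy_def by (intro exI[of _ "\<lambda>l i. 0"]) simp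

lemma m_syzygy_add:
  assumes "m_syzygy s" "m_syzygy t"
  shows "m_syzygy (\<lambda>i. s i + t i)"
proof -
  from assms obtain z w where
    "\<forall>l. (\<Sum>i\<in>UNIV. mvar i * z l i) = 0" "\<forall>i. s i = (\<Sum>l\<in>UNIV. mvar l * z l i)"
    "\<forall>l. (\<Sum>i\<in>UNIV. mvar i * w l i) = 0" "\<forall>i. t i = (\<Sum>l\<in>UNIV. mvar l * w l i)"
    unfolding m_syzygy_def by blast
  then show ?thesis
    unfolding m_syzygy_def
    by (intro exI[of _ "\<lambda>l i. z l i + w l i"]) (simp add: distrib_left sum.distrib)
qed

lemma m_syzygy_scale:
  assumes "m_syzygy s"
  shows "m_syzygy (\<lambda>i. c * s i)"
proof -
  from assms obtain z where
    "\<forall>l. (\<Sum>i\<in>UNIV. mvar i * z l i) = 0" "\<forall>i. s i = (\<Sum>l\<in>UNIV. mvar l * z l i)"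
    unfolding m_syzygy_def by blast
  then show ?thesis
    unfolding m_syzygy_def
    by (intro exI[of _ "\<lambda>l i. c * z l i"]) (simp add: sum_distrib_left[symmetric] mult.left_commute)
qed

lemma m_syzygy_sum: "(\<And>a. a \<in> A \<Longrightarrow> m_syzygy (s a)) \<Longrightarrow> m_syzygy (\<lambda>i. \<Sum>a\<in>A. s a i)"
  by (induction A rule: infinite_finite_induct) (auto simp: m_syzygy_zero m_syzygy_add)

lemma lookup_mvar_mult:
  "lookup (mvar i * p) m = (if lookup m i > 0 then lookup p (m - single i 1) else 0)"
proof (induction p rule: poly_mapping_additive_induct)
  case (single k c)
  have "single i 1 + k = m \<longleftrightarrow> lookup m i > 0 \<and> k = m - single i 1"
    by (auto simp: poly_mapping_eq_iff fun_eq_iff lookup_add lookup_minus lookup_single when_def)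
  then show ?case
    by (auto simp: mvar_mult_single lookup_single when_def)
qed (simp add: distrib_left lookup_add)

text \<open>With \<open>M2\<close> the quotient of \<open>M\<close> by both variables, this vector
  is \<open>M2\<close> times the Koszul syzygy on positions \<open>i\<close> and \<open>j\<close>.
  The degree bound makes \<open>M2\<close> nonconstant, so a variable can be split off.\<close>

lemma m_syzygy_koszul:
  assumes ij: "lookup M i > 0" "lookup M j > 0" "i \<noteq> j" and M: "3 \<le> mdeg M"
  shows "m_syzygy (\<lambda>k. (if k = i then single (M - single i 1) 1 else 0)
    - (if k = j then single (M - single j 1) 1 else 0))"
proof -
  obtain M1 where M1: "M = single i 1 + M1"
    using ij(1) by (rule monomial_split)
  then have "lookup M1 j > 0"
    using ij by (auto simp: lookup_add lookup_single)
  then obtain M2 where M2: "M1 = single j 1 + M2"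
    by (rule monomial_split)
  have "M2 \<noteq> 0" using M M1 M2 by auto
  then obtain l N where N: "M2 = single l 1 + N"
    by (rule monomial_nonzero_split)
  have i: "M - single i 1 = single l 1 + (single j 1 + N)"
    unfolding M1 M2 N by (simp add: add.left_commute)
  have "M = single j 1 + (single l 1 + (single i 1 + N))"
    unfolding M1 M2 N by (simp add: add.left_commute)
  then have j: "M - single j 1 = single l 1 + (single i 1 + N)"
    by simp
  define w where "w = (\<lambda>k. (if k = i then single (single j 1 + N) (1::'b) else 0)
    - (if k = j then single (single i 1 + N) 1 else 0))"
  have "mvar k * w k = (if k = i then single (single i 1 + (single j 1 + N)) 1 else 0)
    - (if k = j then single (single i 1 + (single j 1 + N)) 1 else 0)" for k
    by (simp add: w_def right_diff_distrib mvar_mult_single add.left_commute)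
  then have "(\<Sum>k\<in>UNIV. mvar k * w k) = 0"
    by (simp add: sum_subtractf)
  moreover have eq: "(if k = i then single (M - single i 1) 1 else 0)
    - (if k = j then single (M - single j 1) 1 else 0) = mvar l * w k" for k
    unfolding i j w_def by (simp add: right_diff_distrib mvar_mult_single)
  moreover have "(\<Sum>k\<in>UNIV. mvar k * (if l' = l then w k else 0)) = 0" for l'
    using calculation by (cases "l' = l") simp_all
  ultimately show ?thesis
    unfolding m_syzygy_def eq
    by (intro exI[of _ "\<lambda>l' k. if l' = l then w k else 0"] conjI allI)
      (simp_all add: if_distrib[of "\<lambda>x. _ * x"] cong: if_cong)
qed

text \<open>
  The Koszul complex is exact at its linear term and its syzygies have linear entries; a syzygy
  splits into its multigraded pieces, each of which is a combination of Koszul syzygies.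
\<close>

lemma m_syzygy_of_order_ge_2:
  fixes s :: "'x::finite \<Rightarrow> ('x, 'k::field) mpoly"
  assumes syz: "(\<Sum>i\<in>UNIV. mvar i * s i) = 0" and s: "\<And>i m. m \<in> keys (s i) \<Longrightarrow> 2 \<le> mdeg m"
  shows "m_syzygy s"
proof -
  \<comment> \<open>The multidegrees of the relation. The piece \<open>sM M\<close> of
    \<open>s\<close> has in position \<open>i\<close> the coefficient \<open>c M i\<close> at the
    monomial \<open>M\<close> divided by the variable \<open>i\<close>.\<close>
  define Ms where "Ms = (\<Union>i\<in>UNIV. (\<lambda>m. single i 1 + m) ` keys (s i))"
  have fin: "finite Ms" by (simp add: Ms_def)
  define c where "c = (\<lambda>M i. if lookup M i > 0 then lookup (s i) (M - single i 1) else 0)"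
  define sM where "sM = (\<lambda>M i. single (M - single i 1) (c M i))"
  have s_eq: "s i = (\<Sum>M\<in>Ms. sM M i)" for i
  proof (rule poly_mapping_eqI)
    fix m
    have eq: "lookup (sM M i) m = (if M = single i 1 + m then lookup (s i) m else 0)" for M
    proof (cases "lookup M i > 0")
      case True
      then obtain M' where "M = single i 1 + M'" by (rule monomial_split)
      with True show ?thesis
        by (auto simp: sM_def c_def lookup_single when_def)
    qed (auto simp: sM_def c_def lookup_add)
    show "lookup (s i) m = lookup (\<Sum>M\<in>Ms. sM M i) m"
    proof -
      have "lookup (s i) m = 0" if "single i 1 + m \<notin> Ms"
      proof (rule ccontr)
        assume "lookup (s i) m \<noteq> 0"
        then have "m \<in> keys (s i)" by (simp add: in_keys_iff)
        then have "single i 1 + m \<in> Ms" unfolding Ms_def by blast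
        with that show False by contradiction
      qed
      then show ?thesis
        unfolding lookup_sum eq using fin by auto
    qed
  qed
  have "m_syzygy (sM M)" for M
  proof (cases "\<forall>i. c M i = 0")
    case True
    then show ?thesis by (simp add: sM_def m_syzygy_zero)
  next
    case False
    then obtain j where j: "c M j \<noteq> 0" by blast
    then have Mj: "lookup M j > 0" by (auto simp: c_def split: if_splits)
    then obtain M' where M': "M = single j 1 + M'" by (rule monomial_split)
    have "2 \<le> mdeg M'"
      using s[of M' j] j Mj by (auto simp: c_def M' in_keys_iff)
    then have M: "3 \<le> mdeg M" by (simp add: M')
    \<comment> \<open>With \<open>j\<close> as reference position, the combination of the vectors
      \<open>t i\<close> with coefficients \<open>c M i\<close> is \<open>sM M\<close> up to a term
      at \<open>j\<close>, whose coefficient is the sum of all \<open>c M i\<close> and vanishes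
      because \<open>s\<close> is a syzygy.\<close>
    define t where "t = (\<lambda>i k. (if k = i then single (M - single i 1) (1::'k) else 0)
      - (if k = j then single (M - single j 1) 1 else 0))"
    have "(\<Sum>i\<in>UNIV. c M i) = lookup (\<Sum>i\<in>UNIV. mvar i * s i) M"
      by (simp add: lookup_sum lookup_mvar_mult c_def)
    then have c0: "(\<Sum>i\<in>UNIV. c M i) = 0" by (simp add: syz)
    have "m_syzygy (\<lambda>k. single 0 (c M i) * t i k)" for i
    proof (cases "c M i = 0 \<or> i = j")
      case True
      then have "(\<lambda>k. single 0 (c M i) * t i k) = (\<lambda>k. 0)" by (auto simp: t_def)
      then show ?thesis by (simp add: m_syzygy_zero)
    next
      case False
      then have "lookup M i > 0" by (auto simp: c_def split: if_splits)
      then show ?thesis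
        unfolding t_def using False M Mj by (intro m_syzygy_scale m_syzygy_koszul) auto
    qed
    then have "m_syzygy (\<lambda>k. \<Sum>i\<in>UNIV. single 0 (c M i) * t i k)"
      by (intro m_syzygy_sum)
    moreover have "(\<Sum>i\<in>UNIV. single 0 (c M i) * t i k) = sM M k" for k
    proof -
      have "(\<Sum>i\<in>UNIV. single 0 (c M i) * t i k) = sM M k
        - (if k = j then single (M - single j 1) (\<Sum>i\<in>UNIV. c M i) else 0)"
        unfolding t_def right_diff_distrib sum_subtractf sM_def
        by (rule arg_cong2[where f = minus])
          (auto simp: if_distrib mult_single intro!: poly_mapping_eqI simp: lookup_sum lookup_single
            when_def sum.delta cong: if_cong)
      then show ?thesis by (simp add: c0)
    qed
    ultimately show ?thesis by simp
  qed
  then have "m_syzygy (\<lambda>i. \<Sum>M\<in>Ms. sM M i)"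
    by (intro m_syzygy_sum)
  then show ?thesis
    using s_eq by presburger
qed

section \<open>The quotient ring and its grading\<close>

locale graded_quotient = graded_ideal I
  for I :: "('x::finite, 'k::field) mpoly set" +
  fixes \<pi> :: "('x, 'k) mpoly \<Rightarrow> 'r::comm_ring_1"
  assumes I_sq: "I \<subseteq> irrelevant_ideal_sq" and quotient: "quotient_map I \<pi>"
begin

lemma \<pi>_add: "\<pi> (p + q) = \<pi> p + \<pi> q"
  and \<pi>_mult: "\<pi> (p * q) = \<pi> p * \<pi> q"
  and \<pi>_1 [simp]: "\<pi> 1 = 1"
  and surj_\<pi>: "surj \<pi>"
  and \<pi>_eq_0_iff: "\<pi> p = 0 \<longleftrightarrow> p \<in> I"
  using quotient by (auto simp: quotient_map_def)

lemma \<pi>_0 [simp]: "\<pi> 0 = 0"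
  by (simp add: \<pi>_eq_0_iff rmod.subspace_0[OF subspace_I])

lemma \<pi>_diff: "\<pi> (p - q) = \<pi> p - \<pi> q"
  using \<pi>_add[of "p - q" q] by simp

lemma \<pi>_sum: "\<pi> (\<Sum>a\<in>A. f a) = (\<Sum>a\<in>A. \<pi> (f a))"
  by (induction A rule: infinite_finite_induct) (auto simp: \<pi>_add)

lemma \<pi>_eq_iff: "\<pi> p = \<pi> q \<longleftrightarrow> p - q \<in> I"
  by (simp add: \<pi>_diff flip: \<pi>_eq_0_iff)

lemma \<pi>_cases: obtains p where "r = \<pi> p"
  using surj_\<pi> by blast

lemma inv_\<pi>: "inv \<pi> (\<pi> p) - p \<in> I"
  by (simp add: surj_f_inv_f[OF surj_\<pi>] flip: \<pi>_eq_iff)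

lemma I_order: "p \<in> I \<Longrightarrow> m \<in> keys p \<Longrightarrow> 2 \<le> mdeg m"
  using I_sq irrelevant_ideal_sq_order by blast

lemma I_lookup_0: "p \<in> I \<Longrightarrow> lookup p 0 = 0"
  using I_order[of p 0] by (auto simp: in_keys_iff)

abbreviation tk where "tk \<equiv> to_k \<pi>"

lemma to_k_\<pi> [simp]: "tk (\<pi> p) = lookup p 0"
  using I_lookup_0[OF inv_\<pi>[of p]] by (simp add: to_k_def lookup_minus)

lemma to_k_add: "tk (r + s) = tk r + tk s"
  by (metis \<pi>_cases \<pi>_add to_k_\<pi> lookup_add)

lemma to_k_mult: "tk (r * s) = tk r * tk s"
  by (metis \<pi>_cases \<pi>_mult to_k_\<pi> lookup_mult_zero)

lemma to_k_0 [simp]: "tk 0 = 0"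
  using to_k_\<pi>[of 0] by simp

lemma to_k_1 [simp]: "tk 1 = 1"
  using to_k_\<pi>[of 1] by (simp add: lookup_one)

lemma module_k_scale: "module (k_scale \<pi>)"
  by unfold_locales (simp_all add: k_scale_def to_k_add to_k_mult distrib_left distrib_right)

definition const :: "'k \<Rightarrow> 'r"
  where "const c = \<pi> (single 0 c)"

lemma to_k_const [simp]: "tk (const c) = c"
  by (simp add: const_def)

lemma const_0 [simp]: "const 0 = 0"
  by (simp add: const_def)

lemma const_1 [simp]: "const 1 = 1"
  by (simp add: const_def)

definition X :: "'x \<Rightarrow> 'r"
  where "X i = \<pi> (mvar i)"

lemma to_k_X [simp]: "tk (X i) = 0"
  by (simp add: X_def homogeneous_lookup_zero[OF homogeneous_mvar])

lemma R_gradedI: "homogeneous e p \<Longrightarrow> \<pi> p \<in> R_graded \<pi> e"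
  by (auto simp: R_graded_def)

lemma R_gradedE:
  assumes "r \<in> R_graded \<pi> e"
  obtains p where "r = \<pi> p" "homogeneous e p"
  using assms by (auto simp: R_graded_def)

lemma const_graded [simp]: "const c \<in> R_graded \<pi> 0"
  unfolding const_def by (rule R_gradedI) (simp add: homogeneous_iff)

lemma X_graded [simp]: "X i \<in> R_graded \<pi> 1"
  unfolding X_def by (intro R_gradedI homogeneous_mvar)

lemma one_graded [simp]: "1 \<in> R_graded \<pi> 0"
  using const_graded[of 1] by simp

lemma zero_graded [simp]: "0 \<in> R_graded \<pi> e"
  using R_gradedI[of e 0] by simp

lemma graded_add: "r \<in> R_graded \<pi> e \<Longrightarrow> s \<in> R_graded \<pi> e \<Longrightarrow> r + s \<in> R_graded \<pi> e"
  by (metis R_gradedE R_gradedI \<pi>_add homogeneous_add)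

lemma graded_mult: "r \<in> R_graded \<pi> d \<Longrightarrow> s \<in> R_graded \<pi> e \<Longrightarrow> r * s \<in> R_graded \<pi> (d + e)"
  by (metis R_gradedE R_gradedI \<pi>_mult homogeneous_mult)

lemma to_k_graded: "r \<in> R_graded \<pi> e \<Longrightarrow> e \<noteq> 0 \<Longrightarrow> tk r = 0"
  by (metis R_gradedE to_k_\<pi> homogeneous_lookup_zero)

lemma graded_0_eq: "r \<in> R_graded \<pi> 0 \<Longrightarrow> r = const (tk r)"
  unfolding const_def by (metis R_gradedE to_k_\<pi> homogeneous_0_eq)

lemma R_induct:
  assumes "\<And>r s. P r \<Longrightarrow> P s \<Longrightarrow> P (r + s)" and "\<And>e r. r \<in> R_graded \<pi> e \<Longrightarrow> P r"
  shows "P r"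
proof -
  obtain p where p: "r = \<pi> p" by (rule \<pi>_cases)
  have "P (\<pi> p)"
  proof (induction p rule: poly_mapping_additive_induct)
    case (single m c)
    show ?case by (rule assms(2)[OF R_gradedI[OF homogeneous_single]])
  qed (simp add: \<pi>_add assms(1))
  then show ?thesis by (simp add: p)
qed

definition Rproj :: "nat set \<Rightarrow> 'r \<Rightarrow> 'r"
  where "Rproj E r = \<pi> (hproj E (inv \<pi> r))"

text \<open>Any representative may be projected, because \<open>I\<close> contains all components of
  its elements.\<close>

lemma Rproj_\<pi>: "Rproj E (\<pi> p) = \<pi> (hproj E p)"
  using hproj_I[OF inv_\<pi>[of p], of E] by (simp add: Rproj_def \<pi>_eq_iff prestrict_minus)

lemma Rproj_add: "Rproj E (r + s) = Rproj E r + Rproj E s"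
  by (metis \<pi>_cases Rproj_\<pi> \<pi>_add prestrict_add)

lemma Rproj_0 [simp]: "Rproj E 0 = 0"
  using Rproj_\<pi>[of E 0] by simp

lemma Rproj_UNIV [simp]: "Rproj UNIV r = r"
  by (simp add: Rproj_def prestrict_id surj_f_inv_f[OF surj_\<pi>])

lemma Rproj_empty [simp]: "Rproj {} r = 0"
  by (simp add: Rproj_def prestrict_eq_0)

lemma Rproj_graded: "r \<in> R_graded \<pi> e \<Longrightarrow> Rproj E r = (if e \<in> E then r else 0)"
  by (metis R_gradedE Rproj_\<pi> hproj_homogeneous \<pi>_0)

lemma Rproj_in_graded: "Rproj {e} r \<in> R_graded \<pi> e"
  unfolding Rproj_def by (intro R_gradedI homogeneous_hproj)

lemma maximal_expansion:
  assumes "tk r = 0"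
  obtains a where "r = (\<Sum>i\<in>UNIV. X i * a i)"
proof -
  obtain p where p: "r = \<pi> p" by (rule \<pi>_cases)
  with assms have "lookup p 0 = 0" by simp
  then obtain q where "p = (\<Sum>i\<in>UNIV. mvar i * q i)" by (rule irrelevant_expansion)
  then show ?thesis
    using that[of "\<lambda>i. \<pi> (q i)"] by (simp add: p \<pi>_sum \<pi>_mult X_def)
qed

lemma maximal_expansion_graded:
  assumes "r \<in> R_graded \<pi> (Suc e)"
  obtains a where "r = (\<Sum>i\<in>UNIV. X i * a i)" "\<And>i. a i \<in> R_graded \<pi> e"
proof -
  obtain p where p: "r = \<pi> p" "homogeneous (Suc e) p" using assms by (rule R_gradedE)
  then have "lookup p 0 = 0" using homogeneous_lookup_zero by blast
  then obtain q where "p = (\<Sum>i\<in>UNIV. mvar i * q i)" "\<And>e i. homogeneous (Suc e) p \<Longrightarrow> homogeneous e (q i)"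
    by (rule irrelevant_expansion) blast
  then show ?thesis
    using that[of "\<lambda>i. \<pi> (q i)"] p by (simp add: \<pi>_sum \<pi>_mult X_def R_gradedI)
qed

end

section \<open>Graded free resolutions\<close>

locale resolution = graded_quotient I \<pi>
  for I :: "('x::finite, 'k::field) mpoly set" and \<pi> :: "('x, 'k) mpoly \<Rightarrow> 'r::comm_ring_1" +
  fixes F :: "('r, 'b, 'k) free_complex"
  assumes res: "graded_free_resolution \<pi> F"
begin

abbreviation d where "d \<equiv> diff F"
abbreviation aug where "aug \<equiv> augm F"
abbreviation basis :: "'b \<Rightarrow> ('b \<Rightarrow>\<^sub>0 'r)" where "basis b \<equiv> single b 1"

sublocale d: module_hom free_scale free_scale d
  using res by (simp add: graded_free_resolution_def R_endomorphism_def)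

sublocale aug: module_hom free_scale "k_scale \<pi>" aug
  using res by (simp add: graded_free_resolution_def R_form_def)

lemma d_graded_Suc: "v \<in> F_graded \<pi> F (Suc i) j \<Longrightarrow> d v \<in> F_graded \<pi> F i j"
  and d_term_0: "v \<in> F_term F 0 \<Longrightarrow> d v = 0"
  and aug_graded: "v \<in> F_graded \<pi> F 0 j \<Longrightarrow> j \<noteq> 0 \<Longrightarrow> aug v = 0"
  and aug_term: "v \<in> F_term F i \<Longrightarrow> i \<noteq> 0 \<Longrightarrow> aug v = 0"
  and surj_aug: "surj aug"
  and exact_0: "{v \<in> F_term F 0. aug v = 0} = d ` F_term F 1"
  and exact_Suc: "{v \<in> F_term F (Suc i). d v = 0} = d ` F_term F (Suc (Suc i))"
  using res by (auto simp: graded_free_resolution_def)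

lemma F_graded_term: "v \<in> F_graded \<pi> F i j \<Longrightarrow> v \<in> F_term F i"
  by (simp add: F_graded_def)

lemma single_graded: "r \<in> R_graded \<pi> e \<Longrightarrow> single b r \<in> F_graded \<pi> F (hdeg F b) (ideg F b + int e)"
  by (auto simp: F_graded_def F_term_def)

lemma basis_graded: "basis b \<in> F_graded \<pi> F (hdeg F b) (ideg F b)"
  using single_graded[of 1 0 b] by simp

lemma F_graded_scale:
  assumes "r \<in> R_graded \<pi> e" "v \<in> F_graded \<pi> F i j"
  shows "free_scale r v \<in> F_graded \<pi> F i (j + int e)"
  unfolding F_graded_def F_term_def
proof (intro CollectI conjI ballI)
  fix b assume "b \<in> keys (free_scale r v)"
  then have b: "b \<in> keys v" by (auto simp: in_keys_iff)
  then show "hdeg F b = i" using assms(2) by (simp add: F_graded_def F_term_def)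
  from b obtain e' where "ideg F b + int e' = j" "lookup v b \<in> R_graded \<pi> e'"
    using assms(2) by (auto simp: F_graded_def)
  then show "\<exists>e'. ideg F b + int e' = j + int e \<and> lookup (free_scale r v) b \<in> R_graded \<pi> e'"
    using graded_mult[OF assms(1)] by (intro exI[of _ "e + e'"]) simp
qed

lemma F_term_add: "v \<in> F_term F i \<Longrightarrow> w \<in> F_term F i \<Longrightarrow> v + w \<in> F_term F i"
  using keys_add[of v w] by (auto simp: F_term_def)

lemma F_term_0 [simp]: "0 \<in> F_term F i"
  by (simp add: F_term_def)

lemma F_induct [case_names add graded]:
  assumes "\<And>v w. P v \<Longrightarrow> P w \<Longrightarrow> P (v + w)" and "\<And>p q v. v \<in> F_graded \<pi> F p q \<Longrightarrow> P v"
  shows "P v"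
proof (induction v rule: poly_mapping_additive_induct)
  case (single b r)
  show ?case
    by (induction r rule: R_induct) (simp_all add: single_add assms(1) assms(2)[OF single_graded])
qed (rule assms(1))

text \<open>Projection to the sum of the bigraded pieces indexed by \<open>A\<close>, the scalars
  contributing to the internal degree. As \<open>A\<close> may be infinite,
  \<open>Fproj A v = v\<close> serves as a degree condition on inhomogeneous elements.\<close>

definition Fproj :: "(nat \<times> int) set \<Rightarrow> ('b \<Rightarrow>\<^sub>0 'r) \<Rightarrow> ('b \<Rightarrow>\<^sub>0 'r)"
  where "Fproj A = Poly_Mapping.mapp (\<lambda>b. Rproj {e. (hdeg F b, ideg F b + int e) \<in> A})"

lemma lookup_Fproj: "lookup (Fproj A v) b = Rproj {e. (hdeg F b, ideg F b + int e) \<in> A} (lookup v b)"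
  by (simp add: Fproj_def lookup_mapp when_def in_keys_iff)

lemma Fproj_add: "Fproj A (v + w) = Fproj A v + Fproj A w"
  by (rule poly_mapping_eqI) (simp add: lookup_Fproj lookup_add Rproj_add)

lemma Fproj_0 [simp]: "Fproj A 0 = 0"
  by (rule poly_mapping_eqI) (simp add: lookup_Fproj)

lemma Fproj_graded:
  assumes "v \<in> F_graded \<pi> F p q"
  shows "Fproj A v = (if (p, q) \<in> A then v else 0)"
proof (rule poly_mapping_eqI)
  fix b
  show "lookup (Fproj A v) b = lookup (if (p, q) \<in> A then v else 0) b"
  proof (cases "b \<in> keys v")
    case True
    then obtain e where "ideg F b + int e = q" "lookup v b \<in> R_graded \<pi> e" "hdeg F b = p"
      using assms by (auto simp: F_graded_def F_term_def)
    then show ?thesis by (auto simp: lookup_Fproj Rproj_graded)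
  qed (simp add: lookup_Fproj in_keys_iff)
qed

lemma Fproj_in_graded: "Fproj {(p, q)} v \<in> F_graded \<pi> F p q"
proof (induction v rule: F_induct)
  case (add v w)
  have "Fproj {(p, q)} (v + w) \<in> F_term F p"
    using add by (simp add: Fproj_add F_graded_term F_term_add)
  moreover have "\<exists>e. ideg F b + int e = q \<and> lookup (Fproj {(p, q)} (v + w)) b \<in> R_graded \<pi> e"
    if b: "b \<in> keys (Fproj {(p, q)} (v + w))" for b
  proof -
    let ?E = "{e. (hdeg F b, ideg F b + int e) \<in> {(p, q)}}"
    have "?E \<noteq> {}"
      using b by (metis Rproj_empty in_keys_iff lookup_Fproj)
    then obtain e where e: "e \<in> ?E" by blast
    then have "?E = {e}" by auto
    then have "lookup (Fproj {(p, q)} (v + w)) b \<in> R_graded \<pi> e"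
      by (metis Rproj_in_graded lookup_Fproj)
    with e show ?thesis by blast
  qed
  ultimately show ?case by (simp add: F_graded_def)
next
  case (graded p' q' v)
  then show ?case
    by (auto simp: Fproj_graded F_graded_def)
qed

lemma Fproj_Fproj: "Fproj A (Fproj B v) = Fproj (A \<inter> B) v"
  by (induction v rule: F_induct) (auto simp: Fproj_add Fproj_graded)

lemma d_Fproj: "d (Fproj A v) = Fproj {(p, q). (Suc p, q) \<in> A} (d v)"
proof (induction v rule: F_induct)
  case (graded p q v)
  then show ?case
    by (cases p) (auto simp: Fproj_graded F_graded_term d_term_0 dest: d_graded_Suc)
qed (simp add: Fproj_add d.add)

section \<open>Exactness of the total complex\<close>

lemma d_d [simp]: "d (d v) = 0"
proof (induction v rule: F_induct)
  case (graded p q v)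
  then have v: "v \<in> F_term F p" by (rule F_graded_term)
  show ?case
  proof (cases p)
    case 0
    with v show ?thesis by (simp add: d_term_0)
  next
    case (Suc p')
    show ?thesis
    proof (cases p')
      case 0
      then show ?thesis
        using graded d_graded_Suc[of v 0 q] Suc by (simp add: d_term_0 F_graded_term)
    next
      case (Suc p'')
      then show ?thesis
        using v exact_Suc[of p''] \<open>p = Suc p'\<close> by blast
    qed
  qed
qed (simp add: d.add)

lemma aug_d [simp]: "aug (d v) = 0"
proof (induction v rule: F_induct)
  case (graded p q v)
  then have v: "v \<in> F_term F p" by (rule F_graded_term)
  show ?case
  proof (cases p)
    case 0
    with v show ?thesis by (simp add: d_term_0)
  next
    case (Suc p')
    show ?thesis
    proof (cases p')
      case 0
      then show ?thesis
        using v exact_0 \<open>p = Suc p'\<close> by auto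
    next
      case (Suc p'')
      then show ?thesis
        using graded \<open>p = Suc p'\<close> F_graded_term[OF d_graded_Suc] aug_term by blast
    qed
  qed
qed (simp add: d.add aug.add)

lemma d_term: "v \<in> F_term F (Suc i) \<Longrightarrow> d v \<in> F_term F i"
proof (cases i)
  case 0
  then show "v \<in> F_term F (Suc i) \<Longrightarrow> d v \<in> F_term F i"
    using exact_0 by auto
next
  case (Suc i')
  then show "v \<in> F_term F (Suc i) \<Longrightarrow> d v \<in> F_term F i"
    using exact_Suc[of i'] by auto
qed

text \<open>Split \<open>u\<close> into homological components and lift each by termwise exactness;
  the augmentation of \<open>u\<close> is that of its component in \<open>F_0\<close>.\<close>

lemma exact:
  assumes "d u = 0" "aug u = 0"
  obtains w where "d w = u"
proof -
  \<comment> \<open>The index 0 is adjoined so that the component seen by the augmentation is always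
    among the summands.\<close>
  define P where "P = insert 0 (hdeg F ` keys u)"
  define c where "c = (\<lambda>p. Fproj ({p} \<times> UNIV) u)"
  have lookup_c: "lookup (c p) b = (if hdeg F b = p then lookup u b else 0)" for p b
    by (simp add: c_def lookup_Fproj)
  have fin: "finite P" by (simp add: P_def)
  have u: "u = (\<Sum>p\<in>P. c p)"
    by (rule poly_mapping_eqI) (use fin in \<open>auto simp: lookup_sum lookup_c P_def in_keys_iff\<close>)
  have c: "c p \<in> F_term F p" for p
    by (auto simp: F_term_def in_keys_iff lookup_c split: if_splits)
  have "aug u = (\<Sum>p\<in>P. aug (c p))"
    by (subst u) (rule aug.sum)
  also have "\<dots> = aug (c 0)"
    using fin aug_term[OF c] by (subst sum.mono_neutral_right[of P "{0}"]) (auto simp: P_def)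
  finally have aug_c: "aug (c 0) = 0" using assms(2) by simp
  have dc: "d (c p) = 0" for p
    by (simp add: c_def d_Fproj assms(1))
  have "\<exists>w. d w = c p" for p
  proof (cases p)
    case 0
    then show ?thesis using exact_0 c[of 0] aug_c by (metis (mono_tags, lifting) imageE mem_Collect_eq)
  next
    case (Suc p')
    then show ?thesis using exact_Suc[of p'] c[of p] dc[of p] by (metis (mono_tags, lifting) imageE mem_Collect_eq)
  qed
  then obtain w where "\<And>p. d (w p) = c p" by metis
  then have "d (\<Sum>p\<in>P. w p) = u"
    by (simp add: d.sum flip: u)
  then show ?thesis by (rule that)
qed

section \<open>Tor as the homology of the reduced complex\<close>

abbreviation t where "t \<equiv> tensor_k \<pi>"

lemma lookup_t [simp]: "lookup (t v) b = tk (lookup v b)"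
  by (simp add: tensor_k_def)

lemma t_add: "t (v + w) = t v + t w"
  by (rule poly_mapping_eqI) (simp add: lookup_add to_k_add)

lemma t_scale: "t (free_scale r v) = free_scale (tk r) (t v)"
  by (rule poly_mapping_eqI) (simp add: to_k_mult)

lemma t_0 [simp]: "t 0 = 0"
  by (rule poly_mapping_eqI) simp

lemma t_diff: "t (v - w) = t v - t w"
  using t_add[of "v - w" w] by simp

lemma t_sum: "t (\<Sum>a\<in>A. f a) = (\<Sum>a\<in>A. t (f a))"
  by (induction A rule: infinite_finite_induct) (auto simp: t_add)

text \<open>The kernel of the reduction is the irrelevant ideal times \<open>F\<close>, because the
  variables generate the kernel of the augmentation of \<open>R\<close>.\<close>

lemma t_eq_0_expansion:
  assumes "t v = 0"
  obtains w where "v = (\<Sum>i\<in>UNIV. free_scale (X i) (w i))"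
proof -
  have "tk (lookup v b) = 0" for b
    using assms by (metis lookup_t lookup_zero)
  then have "\<exists>a. lookup v b = (\<Sum>i\<in>UNIV. X i * a i)" for b
    using maximal_expansion by metis
  then obtain a where a: "\<And>b. lookup v b = (\<Sum>i\<in>UNIV. X i * a b i)" by metis
  define w where "w = (\<lambda>i. \<Sum>b\<in>keys v. single b (a b i))"
  have "v = (\<Sum>b\<in>keys v. single b (lookup v b))"
    by (simp add: sum_single)
  also have "\<dots> = (\<Sum>i\<in>UNIV. \<Sum>b\<in>keys v. free_scale (X i) (single b (a b i)))"
  proof (subst sum.swap, rule sum.cong[OF refl])
    fix b
    show "single b (lookup v b) = (\<Sum>i\<in>UNIV. free_scale (X i) (single b (a b i)))"
      by (rule poly_mapping_eqI) (simp add: a lookup_sum lookup_single when_def free_scale_single)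
  qed
  also have "\<dots> = (\<Sum>i\<in>UNIV. free_scale (X i) (w i))"
    by (simp add: w_def free.scale_sum_right)
  finally show ?thesis by (rule that)
qed

lemma t_hom_eq_0:
  assumes "module_hom free_scale free_scale \<phi>" "t v = 0"
  shows "t (\<phi> v) = 0"
proof -
  interpret \<phi>: module_hom free_scale free_scale \<phi> by (fact assms(1))
  from assms(2) obtain w where "v = (\<Sum>i\<in>UNIV. free_scale (X i) (w i))"
    by (rule t_eq_0_expansion)
  then show ?thesis by (simp add: \<phi>.sum \<phi>.scale t_sum t_scale)
qed

definition D :: "('b \<Rightarrow>\<^sub>0 'k) \<Rightarrow> ('b \<Rightarrow>\<^sub>0 'k)"
  where "D = lin free_scale (\<lambda>b. t (d (basis b)))"

sublocale D: module_hom free_scale free_scale D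
  unfolding D_def by (rule free.module_hom_lin)

lemma t_single: "t (single b r) = single b (tk r)"
  by (rule poly_mapping_eqI) (simp add: lookup_single when_def)

lemma t_d: "t (d v) = D (t v)"
proof (induction v rule: poly_mapping_additive_induct)
  case (single b r)
  have "t (d (single b r)) = free_scale (tk r) (t (d (basis b)))"
    by (simp add: free.hom_single[OF d.module_hom_axioms, of b r] t_scale)
  also have "\<dots> = D (t (single b r))"
    by (simp add: D_def t_single free.lin_single)
  finally show ?case .
qed (simp add: d.add t_add D.add)

text \<open>A \<open>k\<close>-linear section of \<open>t\<close> that keeps bidegrees; in general
  it does not commute with the differentials.\<close>

definition lift :: "('b \<Rightarrow>\<^sub>0 'k) \<Rightarrow> ('b \<Rightarrow>\<^sub>0 'r)"
  where "lift = Poly_Mapping.map const"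

lemma t_lift [simp]: "t (lift x) = x"
  by (rule poly_mapping_eqI) (simp add: lift_def)

definition bideg :: "nat \<Rightarrow> int \<Rightarrow> 'b set"
  where "bideg p q = {b. hdeg F b = p \<and> ideg F b = q}"

text \<open>Coefficients of positive degree die in \<open>k\<close>, so only basis elements whose
  own internal degree is \<open>q\<close> survive.\<close>

lemma keys_t: "v \<in> F_graded \<pi> F p q \<Longrightarrow> keys (t v) \<subseteq> bideg p q"
proof
  fix b assume v: "v \<in> F_graded \<pi> F p q" and "b \<in> keys (t v)"
  then have tb: "tk (lookup v b) \<noteq> 0" by (simp add: in_keys_iff)
  then have "b \<in> keys v" by (auto simp: in_keys_iff)
  then obtain e where "ideg F b + int e = q" "lookup v b \<in> R_graded \<pi> e" "hdeg F b = p"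
    using v by (auto simp: F_graded_def F_term_def)
  with tb show "b \<in> bideg p q"
    using to_k_graded by (cases "e = 0") (auto simp: bideg_def)
qed

lemma lift_graded:
  assumes "keys x \<subseteq> bideg p q"
  shows "lift x \<in> F_graded \<pi> F p q"
proof -
  have "hdeg F b = p \<and> ideg F b = q" if "b \<in> keys (lift x)" for b
  proof -
    from that have "lookup x b \<noteq> 0" by (auto simp: lift_def in_keys_iff)
    with assms show ?thesis by (auto simp: bideg_def in_keys_iff)
  qed
  then show ?thesis
    by (auto simp: F_graded_def F_term_def lift_def intro!: exI[of _ 0])
qed

lemma D_D [simp]: "D (D x) = 0"
  using t_d[of "d (lift x)"] by (simp add: t_d)

lemma D_prestrict:
  "D (prestrict {b. (hdeg F b, ideg F b) \<in> A} x)
    = prestrict {b. (Suc (hdeg F b), ideg F b) \<in> A} (D x)"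
proof (induction x rule: poly_mapping_additive_induct)
  case (single b c)
  let ?x = "single b c"
  have x: "keys ?x \<subseteq> bideg (hdeg F b) (ideg F b)" by (simp add: bideg_def)
  have Dx: "D ?x = t (d (lift ?x))" by (simp add: t_d)
  show ?case
  proof (cases "hdeg F b")
    case 0
    then have "D ?x = 0"
      unfolding Dx using lift_graded[OF x] by (simp add: F_graded_term d_term_0)
    then show ?thesis by (simp add: prestrict_single)
  next
    case (Suc p)
    then have "keys (D ?x) \<subseteq> bideg p (ideg F b)"
      unfolding Dx using lift_graded[OF x] by (intro keys_t d_graded_Suc) simp
    then show ?thesis
      using Suc by (cases "(Suc p, ideg F b) \<in> A")
        (auto simp: prestrict_single bideg_def intro!: prestrict_id[symmetric] prestrict_eq_0)
  qed
qed (simp add: D.add prestrict_add)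

lemma prestrict_D: "prestrict (bideg p q) (D x) = D (prestrict (bideg (Suc p) q) x)"
  using D_prestrict[of "{(Suc p, q)}" x] by (simp add: bideg_def)

lemma Tor_cycles_eq: "Tor_cycles \<pi> F i j = {x. keys x \<subseteq> bideg i j \<and> D x = 0}"
proof (intro equalityI subsetI)
  fix x assume "x \<in> {x. keys x \<subseteq> bideg i j \<and> D x = 0}"
  then show "x \<in> Tor_cycles \<pi> F i j"
    unfolding Tor_cycles_def by (intro CollectI exI[of _ "lift x"]) (simp add: lift_graded t_d)
qed (auto simp: Tor_cycles_def t_d dest: keys_t)

lemma Tor_boundaries_eq: "Tor_boundaries \<pi> F i j = D ` {x. keys x \<subseteq> bideg (Suc i) j}"
proof (intro equalityI subsetI)
  fix x assume "x \<in> D ` {x. keys x \<subseteq> bideg (Suc i) j}"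
  then obtain y where "keys y \<subseteq> bideg (Suc i) j" "x = D y" by blast
  then show "x \<in> Tor_boundaries \<pi> F i j"
    unfolding Tor_boundaries_def by (intro CollectI exI[of _ "lift y"]) (simp add: lift_graded t_d)
qed (auto simp: Tor_boundaries_def t_d dest: keys_t)

text \<open>Boundaries may be taken from the whole range of \<open>D\<close>: as \<open>D\<close>
  respects the bigrading, a preimage of a bihomogeneous element can be projected to the right
  bidegree.\<close>

lemma Tor_nonzero_iff:
  "Tor_nonzero \<pi> F i j \<longleftrightarrow> (\<exists>x. keys x \<subseteq> bideg i j \<and> D x = 0 \<and> x \<notin> range D)"
proof -
  have "x \<in> D ` {x. keys x \<subseteq> bideg (Suc i) j} \<longleftrightarrow> x \<in> range D" if x: "keys x \<subseteq> bideg i j" for x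
  proof
    assume "x \<in> range D"
    then obtain y where y: "x = D y" by blast
    have "x = D (prestrict (bideg (Suc i) j) y)"
      by (metis prestrict_D prestrict_id x y)
    then show "x \<in> D ` {x. keys x \<subseteq> bideg (Suc i) j}" by auto
  qed auto
  moreover have "keys (D x) \<subseteq> bideg i j" if x: "keys x \<subseteq> bideg (Suc i) j" for x
  proof -
    have "prestrict (bideg i j) (D x) = D x"
      using x by (simp add: prestrict_D prestrict_id)
    then show ?thesis by (metis inf_le2 keys_prestrict)
  qed
  ultimately have eq: "D ` {x. keys x \<subseteq> bideg (Suc i) j} = {x. keys x \<subseteq> bideg i j \<and> x \<in> range D}"
    by blast
  show ?thesis
    unfolding Tor_nonzero_def Tor_cycles_eq Tor_boundaries_eq eq by auto
qed

section \<open>Cocycles concentrated in bounded internal degrees\<close>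

definition fbar :: "(('b \<Rightarrow>\<^sub>0 'r) \<Rightarrow> 'k) \<Rightarrow> ('b \<Rightarrow>\<^sub>0 'k) \<Rightarrow> 'k"
  where "fbar f = lin (*) (\<lambda>b. f (basis b))"

lemma module_hom_fbar: "module_hom free_scale (*) (fbar f)"
  unfolding fbar_def by (rule rmod.module_hom_lin)

lemma fbar_t:
  assumes "R_form \<pi> f"
  shows "fbar f (t v) = f v"
proof (induction v rule: poly_mapping_additive_induct)
  case (add v w)
  then show ?case
    using assms by (simp add: t_add module_hom.add[OF module_hom_fbar] R_form_def module_hom.add)
next
  case (single b r)
  show ?case
    using module.hom_single[OF module_k_scale assms[unfolded R_form_def], of b r]
    by (simp add: fbar_def t_single rmod.lin_single k_scale_def)
qed

lemma R_form_comp_t: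
  assumes "module_hom free_scale (*) \<phi>"
  shows "R_form \<pi> (\<lambda>v. \<phi> (t v))"
proof -
  interpret \<phi>: module_hom free_scale "(*)" \<phi> by (fact assms)
  interpret k: module "k_scale \<pi>" by (rule module_k_scale)
  show ?thesis
    unfolding R_form_def
    by unfold_locales (simp_all add: t_add t_scale \<phi>.add \<phi>.scale k_scale_def)
qed

lemma form_add: "R_form \<pi> f \<Longrightarrow> f (v + w) = f v + f w"
  by (simp add: R_form_def module_hom.add)

lemma form_0: "R_form \<pi> f \<Longrightarrow> f 0 = 0"
  by (simp add: R_form_def module_hom.zero)

lemma cocycle_form: "f \<in> cocycles \<pi> F \<Longrightarrow> R_form \<pi> f"
  by (simp add: cocycles_def cochains_def)

lemma cohomologous_refl: "f \<in> cocycles \<pi> F \<Longrightarrow> (f, f) \<in> cohomologous \<pi> F"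
proof -
  have "module_hom (free_scale :: 'k \<Rightarrow> ('b \<Rightarrow>\<^sub>0 'k) \<Rightarrow> _) (*) (\<lambda>x. 0)"
    by (intro module_pair.module_hom_zero module_pair.intro module_free_scale module_mult)
  then have "R_form \<pi> (\<lambda>v :: 'b \<Rightarrow>\<^sub>0 'r. 0)"
    by (rule R_form_comp_t[of "\<lambda>_. 0"])
  then have "(\<lambda>v :: 'b \<Rightarrow>\<^sub>0 'r. 0) \<in> cochains \<pi> F"
    by (simp add: cochains_def)
  then show "f \<in> cocycles \<pi> F \<Longrightarrow> (f, f) \<in> cohomologous \<pi> F"
    by (auto simp: cohomologous_def)
qed

lemma Ext_class_self: "f \<in> cocycles \<pi> F \<Longrightarrow> f \<in> Ext_class \<pi> F f"
  by (simp add: Ext_class_def cohomologous_refl)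

text \<open>Cutting a functional down to one homological degree enforces the finiteness condition in
  \<open>cochains\<close>.\<close>

lemma cochain_prestrict:
  assumes "module_hom free_scale (*) \<phi>"
  shows "(\<lambda>v. \<phi> (prestrict {b. hdeg F b = i} (t v))) \<in> cochains \<pi> F"
proof -
  interpret \<phi>: module_hom free_scale "(*)" \<phi> by (fact assms)
  have hom: "module_hom free_scale (*) (\<lambda>x. \<phi> (prestrict {b. hdeg F b = i} x))"
  proof unfold_locales
    fix c :: 'k and x :: "'b \<Rightarrow>\<^sub>0 'k"
    have "prestrict {b. hdeg F b = i} (free_scale c x) = free_scale c (prestrict {b. hdeg F b = i} x)"
      by (rule poly_mapping_eqI) (simp add: when_def)
    then show "\<phi> (prestrict {b. hdeg F b = i} (free_scale c x)) = c * \<phi> (prestrict {b. hdeg F b = i} x)"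
      by (simp add: \<phi>.scale)
  qed (simp add: prestrict_add \<phi>.add)
  have "prestrict {b. hdeg F b = i} (t v) = 0" if "v \<in> F_term F p" "p > i" for v p
    using that by (intro prestrict_eq_0) (auto simp: F_term_def in_keys_iff)
  then show ?thesis
    using R_form_comp_t[OF hom] unfolding cochains_def by (auto intro!: exI[of _ i])
qed

lemma Tor_vanishing_range:
  assumes "\<And>q. q > B \<Longrightarrow> \<not> Tor_nonzero \<pi> F i q"
    and "keys x \<subseteq> {b. hdeg F b = i \<and> ideg F b > B}" and "D x = 0" and "i > 0"
  shows "x \<in> range D"
proof -
  define Q where "Q = ideg F ` keys x"
  have Dq: "prestrict (bideg i q) x \<in> range D" for q
  proof (cases "q > B")
    case True
    obtain i' where "i = Suc i'" using \<open>i > 0\<close> gr0_conv_Suc by blast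
    then have "D (prestrict (bideg i q) x) = 0"
      using assms(3) prestrict_D[of i' q x] by simp
    then show ?thesis
      using assms(1)[OF True] by (auto simp: Tor_nonzero_iff)
  next
    case False
    then have "prestrict (bideg i q) x = 0"
      using assms(2) by (intro prestrict_eq_0) (auto simp: bideg_def)
    then show ?thesis using D.zero by (metis rangeI)
  qed
  have fin: "finite Q" by (simp add: Q_def)
  have "x = (\<Sum>q\<in>Q. prestrict (bideg i q) x)"
  proof (rule poly_mapping_eqI)
    fix b
    have "lookup (prestrict (bideg i q) x) b = (if q = ideg F b then lookup x b else 0)" for q
      using assms(2) by (auto simp: bideg_def when_def in_keys_iff subset_iff)
    then show "lookup x b = lookup (\<Sum>q\<in>Q. prestrict (bideg i q) x) b"
      unfolding lookup_sum using fin by (auto simp: Q_def in_keys_iff)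
  qed
  moreover have "(\<Sum>q\<in>Q. prestrict (bideg i q) x) \<in> range D"
    using Dq by (intro free.subspace_sum D.subspace_image free.subspace_UNIV)
  ultimately show ?thesis by simp
qed

text \<open>The part \<open>\<psi>\<close> of \<open>f\<close> in internal degrees above
  \<open>B\<close> kills all cycles, since cycles there are boundaries; hence it factors through
  \<open>D\<close> and is a coboundary, which is subtracted.\<close>

lemma cohomologous_bounded:
  assumes Tor: "\<And>q. q > B \<Longrightarrow> \<not> Tor_nonzero \<pi> F i q" and i: "i > 0"
    and f: "f \<in> cocycles \<pi> F" "\<And>p v. p \<noteq> i \<Longrightarrow> v \<in> F_term F p \<Longrightarrow> f v = 0"
  obtains f' where "(f, f') \<in> cohomologous \<pi> F"
    and "\<And>p q v. v \<in> F_graded \<pi> F p q \<Longrightarrow> p \<noteq> i \<or> q > B \<Longrightarrow> f' v = 0"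
proof -
  note form = cocycle_form[OF f(1)]
  define H where "H = {b. hdeg F b = i \<and> ideg F b > B}"
  obtain i' where i': "i = Suc i'" using i gr0_conv_Suc by blast
  interpret fb: module_hom free_scale "(*)" "fbar f" by (rule module_hom_fbar)
  have fb_D: "fbar f (D x) = 0" for x
    using f(1) fbar_t[OF form, of "d (lift x)"] by (simp add: t_d cocycles_def)
  define \<psi> where "\<psi> = (\<lambda>x. fbar f (prestrict H x))"
  have \<psi>: "module_hom free_scale (*) \<psi>"
  proof unfold_locales
    fix c :: 'k and x :: "'b \<Rightarrow>\<^sub>0 'k"
    have "prestrict H (free_scale c x) = free_scale c (prestrict H x)"
      by (rule poly_mapping_eqI) (simp add: when_def)
    then show "\<psi> (free_scale c x) = c * \<psi> x"
      by (simp add: \<psi>_def fb.scale)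
  qed (simp add: \<psi>_def prestrict_add fb.add)
  have ker: "\<psi> x = 0" if "D x = 0" for x
  proof -
    have "D (prestrict H x) = 0"
      using D_prestrict[of "{i} \<times> {B<..}" x] that by (simp add: H_def)
    then have "prestrict H x \<in> range D"
      using i by (intro Tor_vanishing_range[OF Tor]) (auto simp: H_def)
    then show ?thesis using fb_D by (auto simp: \<psi>_def)
  qed
  obtain h0
    where h0: "module_hom free_scale (*) h0" "\<And>x. h0 (D x) = \<psi> x"
    using factor_functional[OF D.module_hom_axioms \<psi> ker] by blast
  \<comment> \<open>\<open>h0\<close> is cut to degree \<open>i - 1\<close>, the target of degree
    \<open>i\<close> under \<open>D\<close>; elsewhere it need not vanish on almost all
    terms.\<close>
  define h where "h = (\<lambda>v. h0 (prestrict {b. hdeg F b = i'} (t v)))"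
  have h: "h \<in> cochains \<pi> F"
    unfolding h_def by (rule cochain_prestrict[OF h0(1)])
  have h_d: "h (d v) = \<psi> (t v)" for v
  proof -
    have "h (d v) = \<psi> (prestrict {b. hdeg F b = i} (t v))"
      using D_prestrict[of "{i} \<times> UNIV" "t v"] by (simp add: h_def t_d i' flip: h0(2))
    also have "\<dots> = \<psi> (t v)"
    proof -
      have "H \<inter> {b. hdeg F b = i} = H" by (auto simp: H_def)
      then show ?thesis by (simp add: \<psi>_def prestrict_prestrict)
    qed
    finally show ?thesis .
  qed
  define f' where "f' = (\<lambda>v. f v - h (d v))"
  have f'_eq: "f' v = fbar f (t v) - \<psi> (t v)" for v
    by (simp add: f'_def h_d fbar_t[OF form])
  have "module_hom free_scale (*) (\<lambda>x. fbar f x - \<psi> x)"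
    by (intro module_pair.module_hom_sub module_pair.intro module_free_scale module_mult
        module_hom_fbar \<psi>)
  then have "R_form \<pi> f'"
    using R_form_comp_t[of "\<lambda>x. fbar f x - \<psi> x"] by (simp add: f'_eq[abs_def])
  moreover have "f' v = 0" if v: "v \<in> F_term F p" "p > i" for p v
  proof -
    have "prestrict H (t v) = 0"
      using v by (intro prestrict_eq_0) (auto simp: H_def F_term_def in_keys_iff)
    then show ?thesis
      using f(2)[of p v] v by (simp add: f'_eq fbar_t[OF form] \<psi>_def fb.zero)
  qed
  moreover have "f' (d v) = 0" for v
    using f(1) h by (simp add: f'_def cocycles_def cochains_def form_0)
  ultimately have "f' \<in> cocycles \<pi> F"
    by (auto simp: cocycles_def cochains_def)
  then have "(f, f') \<in> cohomologous \<pi> F"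
    using f(1) h by (auto simp: cohomologous_def f'_def)
  moreover have "f' v = 0" if v: "v \<in> F_graded \<pi> F p q" and pq: "p \<noteq> i \<or> q > B" for p q v
  proof (cases "p = i")
    case False
    then have "prestrict H (t v) = 0"
      using keys_t[OF v] by (intro prestrict_eq_0) (auto simp: H_def bideg_def)
    then show ?thesis
      using f(2)[OF False F_graded_term[OF v]] by (simp add: f'_eq fbar_t[OF form] \<psi>_def fb.zero)
  next
    case True
    then have "prestrict H (t v) = t v"
      using keys_t[OF v] pq by (intro prestrict_id) (auto simp: H_def bideg_def)
    then show ?thesis by (simp add: f'_eq \<psi>_def)
  qed
  ultimately show ?thesis by (rule that)
qed

definition bounded :: "(nat \<Rightarrow> int) \<Rightarrow> (('b \<Rightarrow>\<^sub>0 'r) \<Rightarrow> 'k) \<Rightarrow> bool"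
  where "bounded B f \<longleftrightarrow> f \<in> cocycles \<pi> F \<and> (\<forall>p q. q > B p \<longrightarrow> (\<forall>v \<in> F_graded \<pi> F p q. f v = 0))"

text \<open>A Tor class of bidegree \<open>(i, j)\<close> is detected by a cocycle with value 1 on
  it. Coboundaries vanish on the class, so a bounded representative also has the value 1, which
  excludes \<open>j > B i\<close>.\<close>

lemma Tor_bounded:
  assumes ex: "\<And>f. f \<in> cocycles \<pi> F \<Longrightarrow> \<exists>f'. (f, f') \<in> cohomologous \<pi> F \<and> bounded B f'"
    and Tor: "Tor_nonzero \<pi> F i j"
  shows "j \<le> B i"
proof (rule ccontr)
  assume j: "\<not> j \<le> B i"
  from Tor obtain x where x: "keys x \<subseteq> bideg i j" "D x = 0" "x \<notin> range D"
    by (auto simp: Tor_nonzero_iff)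
  obtain \<phi> where \<phi>: "module_hom free_scale (*) \<phi>" "\<And>y. \<phi> (D y) = 0" "\<phi> x = 1"
    using separating_functional[OF D.module_hom_axioms x(3)] by blast
  define f where "f = (\<lambda>v. \<phi> (prestrict {b. hdeg F b = i} (t v)))"
  have "f \<in> cochains \<pi> F"
    unfolding f_def by (rule cochain_prestrict[OF \<phi>(1)])
  moreover have "f (d v) = 0" for v
  proof -
    have "prestrict {b. hdeg F b = i} (D (t v)) = D (prestrict {b. hdeg F b = Suc i} (t v))"
      using D_prestrict[of "{Suc i} \<times> UNIV" "t v"] by simp
    then show ?thesis by (simp add: f_def t_d \<phi>(2))
  qed
  ultimately have "f \<in> cocycles \<pi> F"
    by (simp add: cocycles_def)
  then obtain f' where f': "(f, f') \<in> cohomologous \<pi> F" "bounded B f'"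
    using ex by blast
  then obtain h where h: "h \<in> cochains \<pi> F" "\<And>v. f v - f' v = h (d v)"
    by (auto simp: cohomologous_def)
  have "prestrict {b. hdeg F b = i} x = x"
    using x(1) by (intro prestrict_id) (auto simp: bideg_def)
  then have "f (lift x) = 1"
    by (simp add: f_def \<phi>(3))
  moreover have "f' (lift x) = 0"
    using f'(2) lift_graded[OF x(1)] j by (simp add: bounded_def not_le)
  moreover have "h (d (lift x)) = 0"
  proof -
    have form: "R_form \<pi> h" using h(1) by (simp add: cochains_def)
    show ?thesis
      using fbar_t[OF form, of "d (lift x)"] module_hom.zero[OF module_hom_fbar, of h]
      by (simp add: t_d x(2))
  qed
  ultimately show False
    using h(2)[of "lift x"] by simp
qed

section \<open>Liftings which respect the internal degree\<close>

lemma aug_graded_eq_0: "v \<in> F_graded \<pi> F p q \<Longrightarrow> (p, q) \<noteq> (0, 0) \<Longrightarrow> aug v = 0"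
  using aug_graded aug_term[OF F_graded_term] by (cases "p = 0") auto

lemma ex_unit: "\<exists>\<epsilon>. \<epsilon> \<in> F_graded \<pi> F 0 0 \<and> aug \<epsilon> = 1"
proof -
  have "aug (Fproj {(0, 0)} v) = aug v" for v
  proof (induction v rule: F_induct)
    case (graded p q v)
    then show ?case
      using aug_graded_eq_0[of v p q] by (auto simp: Fproj_graded)
  qed (simp add: Fproj_add aug.add)
  moreover obtain v where "aug v = 1" using surj_aug by (metis surjD)
  ultimately show ?thesis using Fproj_in_graded by metis
qed

lemma aug_Fproj: "(0, 0) \<notin> A \<Longrightarrow> aug (Fproj A v) = 0"
proof (induction v rule: F_induct)
  case (graded p q v)
  then show ?case
    using aug_graded_eq_0[of v p q] by (cases "(p, q) = (0, 0)") (auto simp: Fproj_graded)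
qed (simp add: Fproj_add aug.add)

lemma Fproj_subset: "Fproj A v = v \<Longrightarrow> A \<subseteq> B \<Longrightarrow> Fproj B v = v"
  by (metis Fproj_Fproj inf.absorb2)

lemma Fproj_sum: "Fproj A (\<Sum>a\<in>S. f a) = (\<Sum>a\<in>S. Fproj A (f a))"
  by (induction S rule: infinite_finite_induct) (auto simp: Fproj_add)

lemma Fproj_scale:
  assumes "r \<in> R_graded \<pi> e"
  shows "Fproj A (free_scale r v) = free_scale r (Fproj {(p, q). (p, q + int e) \<in> A} v)"
  by (induction v rule: F_induct)
    (auto simp: free.scale_right_distrib Fproj_add Fproj_graded Fproj_graded[OF F_graded_scale[OF assms]])

lemma Fproj_keys:
  assumes "Fproj A v = v" "b \<in> keys v"
  shows "\<exists>q. (hdeg F b, q) \<in> A"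
proof (rule ccontr)
  assume "\<not> ?thesis"
  then have "lookup (Fproj A v) b = 0" by (simp add: lookup_Fproj)
  then show False using assms by (simp add: in_keys_iff)
qed

lemma form_Fproj:
  assumes "R_form \<pi> f" "\<And>p q v. (p, q) \<in> A \<Longrightarrow> v \<in> F_graded \<pi> F p q \<Longrightarrow> f v = 0"
  shows "f (Fproj A v) = 0"
  by (induction v rule: F_induct) (auto simp: Fproj_add Fproj_graded form_add[OF assms(1)] form_0[OF assms(1)] assms(2))

lemma form_keys:
  assumes "R_form \<pi> f" "\<And>b. b \<in> keys v \<Longrightarrow> f (basis b) = 0"
  shows "f v = 0"
proof -
  have "f v = lin (k_scale \<pi>) (\<lambda>b. f (basis b)) v"
    using assms(1) by (intro module.hom_eq_lin module_k_scale) (simp add: R_form_def)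
  then show ?thesis by (simp add: lin_def assms(2))
qed

lemma basis_term: "basis b \<in> F_term F (hdeg F b)"
  by (simp add: F_term_def)

text \<open>The usual comparison argument, with every chosen preimage under \<open>d\<close>
  projected to the bidegrees in \<open>A i j\<close>. The allowance \<open>B (i - p)\<close> depends
  only on the drop in homological degree, so the projection is compatible with
  \<open>d\<close>.\<close>

lemma lifting_exists:
  fixes B :: "nat \<Rightarrow> int" and g :: "('b \<Rightarrow>\<^sub>0 'r) \<Rightarrow> 'k"
  assumes g: "bounded B g"
  obtains \<gamma> N where "\<gamma> \<in> liftings F g"
    and "\<And>i j v. v \<in> F_graded \<pi> F i j \<Longrightarrow>
      Fproj {(p, q). p \<le> i \<and> i \<le> p + N \<and> j - B (i - p) \<le> q} (\<gamma> v) = \<gamma> v"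
proof -
  have gform: "R_form \<pi> g" and gd: "\<And>v. g (d v) = 0"
    using g by (auto simp: bounded_def cocycles_def cochains_def)
  have ghom: "module_hom free_scale (k_scale \<pi>) g"
    using gform by (simp add: R_form_def)
  obtain N where N: "\<And>i v. i > N \<Longrightarrow> v \<in> F_term F i \<Longrightarrow> g v = 0"
    using g by (auto simp: bounded_def cocycles_def cochains_def)
  obtain \<epsilon> where \<epsilon>: "\<epsilon> \<in> F_graded \<pi> F 0 0" "aug \<epsilon> = 1" using ex_unit by blast
  define A where "A = (\<lambda>i j. {(p, q). p \<le> i \<and> i \<le> p + N \<and> j - B (i - p) \<le> q})"
  \<comment> \<open>Since \<open>g\<close> may have several cohomological degrees, every basis
    element has a component \<open>c b\<close> in \<open>F_0\<close> carrying the value of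
    \<open>g\<close>, besides the lifted part \<open>C\<close>.\<close>
  define c where "c = (\<lambda>b. free_scale (const (g (basis b))) \<epsilon>)"
  \<comment> \<open>The restriction \<open>p \<ge> 1\<close> makes the augmentation of the lifted
    part vanish, so that the value of \<open>g\<close> comes from \<open>c\<close> alone.\<close>
  define C where "C = (\<lambda>i j u. Fproj (A i j \<inter> {(p, q). p \<ge> 1}) (SOME w. d w = u))"
  \<comment> \<open>Recursion over the homological degree: \<open>G n\<close> is final on basis
    elements of degree at most \<open>n\<close>.\<close>
  define G where "G = rec_nat c (\<lambda>n Gn b. if hdeg F b = Suc n
    then C (hdeg F b) (ideg F b) (lin free_scale Gn (d (basis b))) + c b else Gn b)"
  have G_0: "G 0 = c" and G_Suc: "\<And>n b. G (Suc n) b = (if hdeg F b = Suc n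
    then C (hdeg F b) (ideg F b) (lin free_scale (G n) (d (basis b))) + c b else G n b)"
    by (simp_all add: G_def)
  define \<gamma> where "\<gamma> = lin free_scale (\<lambda>b. G (hdeg F b) b)"
  have \<gamma>hom: "module_hom free_scale free_scale \<gamma>"
    unfolding \<gamma>_def by (rule free.module_hom_lin)
  interpret \<gamma>: module_hom free_scale free_scale \<gamma> by (rule \<gamma>hom)
  have \<gamma>_basis: "\<gamma> (basis b) = G (hdeg F b) b" for b
    by (simp add: \<gamma>_def free.lin_single)
  have \<gamma>_0: "\<gamma> (basis b) = c b" if "hdeg F b = 0" for b
    by (simp add: \<gamma>_basis that G_0)
  have \<gamma>_Suc: "\<gamma> (basis b) = C (Suc n) (ideg F b) (\<gamma> (d (basis b))) + c b" if b: "hdeg F b = Suc n" for b n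
  proof -
    have "basis b \<in> F_term F (Suc n)"
      using basis_term[of b] by (simp add: b)
    then have "d (basis b) \<in> F_term F n"
      by (rule d_term)
    then have "lin free_scale (G n) (d (basis b)) = \<gamma> (d (basis b))"
      by (simp add: \<gamma>_def lin_def F_term_def)
    then show ?thesis
      by (simp add: \<gamma>_basis b G_Suc)
  qed
  have c_aug: "aug (c b) = g (basis b)" for b
    by (simp add: c_def aug.scale \<epsilon>(2) k_scale_def)
  have c_d: "d (c b) = 0" for b
    using \<epsilon>(1) by (simp add: c_def d.scale d_term_0 F_graded_term)
  have c_A: "Fproj (A (hdeg F b) (ideg F b)) (c b) = c b" for b
  proof (cases "g (basis b) = 0")
    case False
    then have "hdeg F b \<le> N" "ideg F b \<le> B (hdeg F b)"
      using N[of "hdeg F b" "basis b"] basis_term g basis_graded[of b]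
      by (auto simp: bounded_def not_le[symmetric])
    moreover have "c b \<in> F_graded \<pi> F 0 0"
      using F_graded_scale[OF const_graded \<epsilon>(1), of "g (basis b)"] by (simp add: c_def)
    ultimately show ?thesis
      by (simp add: Fproj_graded A_def)
  qed (simp add: c_def)
  have A_graded: "Fproj (A i j) (\<gamma> v) = \<gamma> v"
    if P: "\<And>b. hdeg F b = i \<Longrightarrow> Fproj (A i (ideg F b)) (\<gamma> (basis b)) = \<gamma> (basis b)"
      and v: "v \<in> F_graded \<pi> F i j" for i j v
  proof -
    have "Fproj (A i j) (free_scale (lookup v b) (\<gamma> (basis b))) = free_scale (lookup v b) (\<gamma> (basis b))"
      if bv: "b \<in> keys v" for b
    proof -
      obtain e where e: "ideg F b + int e = j" "lookup v b \<in> R_graded \<pi> e" and b: "hdeg F b = i"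
        using bv v by (auto simp: F_graded_def F_term_def)
      have "Fproj {(p, q). (p, q + int e) \<in> A i j} (\<gamma> (basis b)) = \<gamma> (basis b)"
        using P[OF b] e(1) by (elim Fproj_subset) (auto simp: A_def)
      then show ?thesis
        by (simp add: Fproj_scale[OF e(2)])
    qed
    then show ?thesis
      by (simp add: free.hom_eq_lin[OF \<gamma>hom, of v] lin_def Fproj_sum)
  qed
  have step: "d (\<gamma> (basis b)) = \<gamma> (d (basis b)) \<and> aug (\<gamma> (basis b)) = g (basis b)
      \<and> Fproj (A (hdeg F b) (ideg F b)) (\<gamma> (basis b)) = \<gamma> (basis b)" for b
  proof (induction "hdeg F b" arbitrary: b)
    case 0
    have "d (basis b) = 0"
      using basis_term[of b] by (simp add: d_term_0 0[symmetric])
    then show ?case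
      using c_A[of b] 0 by (simp add: \<gamma>_0 c_d c_aug)
  next
    case (Suc n)
    define j where "j = ideg F b"
    define u where "u = \<gamma> (d (basis b))"
    have b: "basis b \<in> F_graded \<pi> F (Suc n) j"
      using basis_graded[of b] by (simp add: j_def Suc(2))
    have db: "d (basis b) \<in> F_graded \<pi> F n j"
      using b by (rule d_graded_Suc)
    then have key: "hdeg F b' = n" if "b' \<in> keys (d (basis b))" for b'
      using that by (simp add: F_graded_def F_term_def)
    have "d (\<gamma> (d (basis b))) = \<gamma> (d (d (basis b)))"
      using free.hom_eqI[OF module_hom_compose[OF \<gamma>hom d.module_hom_axioms]
          module_hom_compose[OF d.module_hom_axioms \<gamma>hom], of "d (basis b)"] Suc(1) key by simp
    then have du: "d u = 0" by (simp add: u_def)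
    have "aug (\<gamma> (d (basis b))) = g (d (basis b))"
      using module.hom_eqI[OF module_k_scale module_hom_compose[OF \<gamma>hom aug.module_hom_axioms] ghom, of "d (basis b)"]
        Suc(1) key by simp
    then have au: "aug u = 0" by (simp add: u_def gd)
    have Au: "Fproj (A n j) u = u"
      unfolding u_def
    proof (rule A_graded[OF _ db])
      fix b' assume "hdeg F b' = n"
      then show "Fproj (A n (ideg F b')) (\<gamma> (basis b')) = \<gamma> (basis b')"
        using Suc(1)[of b'] by simp
    qed
    define w where "w = (SOME w. d w = u)"
    have w: "d w = u"
      unfolding w_def by (rule someI_ex) (use exact[OF du au] in blast)
    \<comment> \<open>Lowering both homological degrees by one keeps the drop, so projecting the
      preimage \<open>w\<close> does not change its boundary \<open>u\<close>.\<close>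
    have "{(p, q). (Suc p, q) \<in> A (Suc n) j \<inter> {(p, q). p \<ge> 1}} = A n j"
      by (auto simp: A_def)
    then have dC: "d (C (Suc n) j u) = u"
      by (simp add: C_def d_Fproj w Au flip: w_def)
    have aC: "aug (C (Suc n) j u) = 0"
      unfolding C_def by (rule aug_Fproj) simp
    have AC: "Fproj (A (Suc n) j) (C (Suc n) j u) = C (Suc n) j u"
      unfolding C_def by (rule Fproj_subset[of "A (Suc n) j \<inter> {(p, q). p \<ge> 1}"]) (auto simp: Fproj_Fproj)
    have "\<gamma> (basis b) = C (Suc n) j u + c b"
      unfolding u_def j_def using \<gamma>_Suc[of b n] Suc(2) by simp
    then show ?case
      using c_A[of b] Suc(2)[symmetric]
      by (simp add: d.add aug.add Fproj_add dC aC AC c_d c_aug j_def[symmetric] u_def[symmetric])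
  qed
  have A\<gamma>: "Fproj (A i j) (\<gamma> v) = \<gamma> v" if "v \<in> F_graded \<pi> F i j" for i j v
    using that by (rule A_graded[rotated]) (use step in metis)
  have "\<gamma> (d v) = d (\<gamma> v)" for v
    using free.hom_eqI[OF module_hom_compose[OF d.module_hom_axioms \<gamma>hom]
        module_hom_compose[OF \<gamma>hom d.module_hom_axioms], of v] step by simp
  moreover have "aug (\<gamma> v) = g v" for v
    using module.hom_eqI[OF module_k_scale module_hom_compose[OF \<gamma>hom aug.module_hom_axioms] ghom, of v] step by simp
  moreover have "hdeg F b \<le> i \<and> i \<le> hdeg F b + N" if v: "v \<in> F_term F i" and b: "b \<in> keys (\<gamma> v)" for i v b
  proof -
    have "\<exists>b'\<in>keys v. lookup (\<gamma> (basis b')) b \<noteq> 0"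
    proof (rule ccontr)
      assume "\<not> ?thesis"
      then have "lookup (\<gamma> v) b = 0"
        by (simp add: free.hom_eq_lin[OF \<gamma>hom, of v] lin_def lookup_sum)
      then show False using b by (simp add: in_keys_iff)
    qed
    then obtain b' where b': "b' \<in> keys v" "b \<in> keys (\<gamma> (basis b'))"
      by (auto simp: in_keys_iff)
    from Fproj_keys[OF A\<gamma>[OF basis_graded] b'(2)] v b'(1) show ?thesis
      by (auto simp: A_def F_term_def)
  qed
  ultimately have "\<gamma> \<in> liftings F g"
    unfolding liftings_def R_endomorphism_def using \<gamma>hom by blast
  then show ?thesis
    using that[of \<gamma> N] A\<gamma> by (simp add: A_def)
qed

section \<open>The Yoneda subalgebra\<close>

text \<open>For \<open>v\<close> of bidegree \<open>(p, q)\<close> with \<open>q > B p\<close>, the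
  component of \<open>\<gamma> v\<close> in homological degree \<open>p'\<close> has internal
  degrees at least \<open>q - B (p - p')\<close>, which exceeds \<open>B p'\<close> by
  superadditivity, so \<open>f\<close> kills it. One good lifting suffices because
  \<open>Yoneda_mult\<close> collects the classes from all liftings.\<close>

lemma bounded_Yoneda_product:
  assumes B: "\<And>i j. B i + B j \<le> B (i + j)" and f: "bounded B f" and g: "bounded B g"
  obtains \<gamma> where "\<gamma> \<in> liftings F g" "bounded B (f \<circ> \<gamma>)"
proof -
  obtain \<gamma> N where \<gamma>: "\<gamma> \<in> liftings F g" "\<And>i j v. v \<in> F_graded \<pi> F i j \<Longrightarrow>
      Fproj {(p, q). p \<le> i \<and> i \<le> p + N \<and> j - B (i - p) \<le> q} (\<gamma> v) = \<gamma> v"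
    using g by (rule lifting_exists) blast
  have fform: "R_form \<pi> f" and fd: "\<And>v. f (d v) = 0"
    using f by (auto simp: bounded_def cocycles_def cochains_def)
  obtain Nf where Nf: "\<And>i v. i > Nf \<Longrightarrow> v \<in> F_term F i \<Longrightarrow> f v = 0"
    using f by (auto simp: bounded_def cocycles_def cochains_def)
  obtain N' where N': "\<And>i v b. v \<in> F_term F i \<Longrightarrow> b \<in> keys (\<gamma> v) \<Longrightarrow> hdeg F b \<le> i \<and> i \<le> hdeg F b + N'"
    using \<gamma>(1) unfolding liftings_def by blast
  have "R_form \<pi> (f \<circ> \<gamma>)"
    using \<gamma>(1) fform unfolding R_form_def liftings_def R_endomorphism_def
    by (auto intro: module_hom_compose)
  moreover have "(f \<circ> \<gamma>) v = 0" if "i > N' + Nf" "v \<in> F_term F i" for i v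
    unfolding o_apply
  proof (rule form_keys[OF fform])
    fix b assume "b \<in> keys (\<gamma> v)"
    then show "f (basis b) = 0"
      using N'[OF that(2)] that(1) by (intro Nf[OF _ basis_term]) fastforce
  qed
  moreover have "(f \<circ> \<gamma>) (d v) = 0" for v
    using \<gamma>(1) fd by (simp add: liftings_def)
  ultimately have "f \<circ> \<gamma> \<in> cocycles \<pi> F"
    unfolding cocycles_def cochains_def by blast
  moreover have "(f \<circ> \<gamma>) v = 0" if q: "q > B p" and v: "v \<in> F_graded \<pi> F p q" for p q v
  proof -
    let ?A = "{(p', q'). p' \<le> p \<and> p \<le> p' + N \<and> q - B (p - p') \<le> q'}"
    have "f (Fproj ?A (\<gamma> v)) = 0"
    proof (rule form_Fproj[OF fform])
      fix p' q' v' assume "(p', q') \<in> ?A" and v': "v' \<in> F_graded \<pi> F p' q'"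
      then have "p' \<le> p" "q - B (p - p') \<le> q'" by auto
      then have "q' > B p'" using B[of p' "p - p'"] q by simp
      then show "f v' = 0" using f v' by (simp add: bounded_def)
    qed
    then show ?thesis by (simp add: \<gamma>(2)[OF v])
  qed
  ultimately have "bounded B (f \<circ> \<gamma>)"
    by (simp add: bounded_def)
  with \<gamma>(1) show ?thesis by (rule that)
qed

lemma cocycle_add:
  assumes "f \<in> cocycles \<pi> F" "g \<in> cocycles \<pi> F"
  shows "(\<lambda>v. f v + g v) \<in> cocycles \<pi> F"
proof -
  obtain N M where NM: "\<forall>i>N. \<forall>v\<in>F_term F i. f v = 0" "\<forall>i>M. \<forall>v\<in>F_term F i. g v = 0"
    using assms by (auto simp: cocycles_def cochains_def)
  have "f v + g v = 0" if "i > max N M" "v \<in> F_term F i" for i v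
    using NM(1)[rule_format, of i v] NM(2)[rule_format, of i v] that by simp
  then have "\<exists>N. \<forall>i>N. \<forall>v\<in>F_term F i. f v + g v = 0"
    by blast
  moreover have "R_form \<pi> (\<lambda>v. f v + g v)"
    unfolding R_form_def
    by (rule module_pair.module_hom_add[OF module_pair.intro[OF module_free_scale module_k_scale]])
      (use assms in \<open>simp_all add: cocycles_def cochains_def R_form_def\<close>)
  ultimately show ?thesis
    using assms by (simp add: cocycles_def cochains_def)
qed

lemma cocycle_scale:
  assumes "f \<in> cocycles \<pi> F"
  shows "(\<lambda>v. c * f v) \<in> cocycles \<pi> F"
proof -
  interpret f: module_hom free_scale "k_scale \<pi>" f
    using assms by (simp add: cocycles_def cochains_def R_form_def)
  have "R_form \<pi> (\<lambda>v. c * f v)"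
    unfolding R_form_def by unfold_locales (simp_all add: f.add f.scale distrib_left k_scale_def)
  then show ?thesis
    using assms by (auto simp: cocycles_def cochains_def)
qed

lemma bounded_aug:
  assumes "B 0 \<ge> 0"
  shows "bounded B aug"
proof -
  have "aug \<in> cocycles \<pi> F"
    using aug_term aug.module_hom_axioms by (auto simp: cocycles_def cochains_def R_form_def)
  moreover have "aug v = 0" if "q > B p" "v \<in> F_graded \<pi> F p q" for p q v
    using that assms aug_graded_eq_0[of v p q] by (cases "p = 0") auto
  ultimately show ?thesis by (simp add: bounded_def)
qed

text \<open>A product of bounded classes is computed by a lifting that respects the internal degrees.\<close>

lemma Yoneda_subalgebra_bounded:
  assumes B: "B 0 \<ge> 0" "\<And>i j. B i + B j \<le> B (i + j)"
    and gen: "\<And>Z. Z \<in> G \<Longrightarrow> \<exists>f\<in>Z. bounded B f"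
    and Z: "Z \<in> Yoneda_subalgebra \<pi> F G"
  shows "\<exists>f\<in>Z. bounded B f"
  using Z
proof induction
  case one
  show ?case
    using bounded_aug[of B] B(1) Ext_class_self by (auto simp: Ext_one_def bounded_def)
next
  case (gen Z)
  then show ?case by (rule assms(3))
next
  case (add Y Z)
  then obtain f g where fg: "f \<in> Y" "bounded B f" "g \<in> Z" "bounded B g" by blast
  then have h: "(\<lambda>v. f v + g v) \<in> cocycles \<pi> F"
    by (intro cocycle_add) (auto simp: bounded_def)
  then have "(\<lambda>v. f v + g v) \<in> Ext_add \<pi> F Y Z"
    unfolding Ext_add_def using fg Ext_class_self by blast
  moreover have "bounded B (\<lambda>v. f v + g v)"
    using fg h by (simp add: bounded_def)
  ultimately show ?case by blast
next
  case (scale Z c)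
  then obtain f where f: "f \<in> Z" "bounded B f" by blast
  then have h: "(\<lambda>v. c * f v) \<in> cocycles \<pi> F"
    by (intro cocycle_scale) (auto simp: bounded_def)
  then have "(\<lambda>v. c * f v) \<in> Ext_scale \<pi> F c Z"
    unfolding Ext_scale_def using f Ext_class_self by blast
  moreover have "bounded B (\<lambda>v. c * f v)"
    using f h by (simp add: bounded_def)
  ultimately show ?case by blast
next
  case (mult Y Z)
  then obtain f g where fg: "f \<in> Y" "bounded B f" "g \<in> Z" "bounded B g" by blast
  obtain \<gamma> where \<gamma>: "\<gamma> \<in> liftings F g" "bounded B (f \<circ> \<gamma>)"
    using B(2) fg(2,4) by (rule bounded_Yoneda_product)
  then have "f \<circ> \<gamma> \<in> Ext_class \<pi> F (f \<circ> \<gamma>)"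
    by (intro Ext_class_self) (simp add: bounded_def)
  then have "f \<circ> \<gamma> \<in> Yoneda_mult \<pi> F Y Z"
    unfolding Yoneda_mult_def using fg \<gamma>(1) by blast
  with \<gamma>(2) show ?case by blast
qed

text \<open>Vanishing of Tor in the degrees of \<open>J\<close> bounds the generators, and
  boundedness of all of Ext then bounds Tor everywhere. Degree 0 is excluded from \<open>J\<close>
  because a generator is corrected by a cochain one degree lower.\<close>

lemma Tor_bounded_of_Yoneda_generated:
  assumes B: "B 0 \<ge> 0" "\<And>i j. B i + B j \<le> B (i + j)"
    and Tor: "\<And>i j. i \<in> J \<Longrightarrow> j > B i \<Longrightarrow> \<not> Tor_nonzero \<pi> F i j" and J: "0 \<notin> J"
    and gen: "Yoneda_subalgebra \<pi> F (\<Union>i\<in>J. Ext_deg \<pi> F i) = Ext \<pi> F"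
    and ij: "Tor_nonzero \<pi> F i j"
  shows "j \<le> B i"
proof (rule Tor_bounded[OF _ ij])
  fix f assume f: "f \<in> cocycles \<pi> F"
  have "\<exists>f\<in>Z. bounded B f" if Z: "Z \<in> (\<Union>i\<in>J. Ext_deg \<pi> F i)" for Z
  proof -
    from Z obtain i f where i: "i \<in> J" "Z = Ext_class \<pi> F f" and f: "f \<in> cocycles \<pi> F"
      "\<And>p v. p \<noteq> i \<Longrightarrow> v \<in> F_term F p \<Longrightarrow> f v = 0"
      by (auto simp: Ext_deg_def)
    have "i > 0" using i J by (metis gr0I)
    obtain f' where f': "(f, f') \<in> cohomologous \<pi> F"
      "\<And>p q v. v \<in> F_graded \<pi> F p q \<Longrightarrow> p \<noteq> i \<or> q > B i \<Longrightarrow> f' v = 0"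
      using Tor[OF i(1)] \<open>i > 0\<close> f by (rule cohomologous_bounded) blast+
    have "f' \<in> Z"
      using f'(1) by (simp add: i Ext_class_def)
    moreover have "bounded B f'"
      using f' by (auto simp: bounded_def cohomologous_def)
    ultimately show ?thesis by blast
  qed
  moreover have "Ext_class \<pi> F f \<in> Yoneda_subalgebra \<pi> F (\<Union>i\<in>J. Ext_deg \<pi> F i)"
    unfolding gen Ext_def Ext_class_def using f by (rule quotientI)
  ultimately have "\<exists>f'\<in>Ext_class \<pi> F f. bounded B f'"
    by (rule Yoneda_subalgebra_bounded[OF B])
  then show "\<exists>f'. (f, f') \<in> cohomologous \<pi> F \<and> bounded B f'"
    by (auto simp: Ext_class_def)
qed

section \<open>Comparison with the start of the minimal resolution\<close>

text \<open>
  The start \<open>R(-1)\<^sup>n \<rightarrow> R \<rightarrow> k\<close> of the minimal resolution is never formed as a module.  The images in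
  \<open>F\<close> of its basis are \<open>unit\<close> and \<open>gen1 i\<close>; the coordinates of the comparison map in the other
  direction are \<open>coeff0\<close> and \<open>coeff1 i\<close>; \<open>htpy0\<close> and \<open>htpy1\<close> are the homotopy between the identity
  and the composite.
\<close>

definition Rz :: "int \<Rightarrow> 'r set"
  where "Rz j = (if j < 0 then {0} else R_graded \<pi> (nat j))"

lemma Rz_0 [simp]: "0 \<in> Rz j"
  by (simp add: Rz_def)

lemma Rz_add: "r \<in> Rz j \<Longrightarrow> s \<in> Rz j \<Longrightarrow> r + s \<in> Rz j"
  by (auto simp: Rz_def graded_add split: if_splits)

lemma Rz_sum: "(\<And>a. a \<in> A \<Longrightarrow> f a \<in> Rz j) \<Longrightarrow> (\<Sum>a\<in>A. f a) \<in> Rz j"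
  by (induction A rule: infinite_finite_induct) (auto simp: Rz_add)

lemma Rz_mult:
  assumes "r \<in> R_graded \<pi> e" "s \<in> Rz j"
  shows "r * s \<in> Rz (j + int e)"
proof (cases "j < 0")
  case False
  then have "r * s \<in> R_graded \<pi> (e + nat j)"
    using assms by (intro graded_mult) (auto simp: Rz_def)
  with False show ?thesis by (simp add: Rz_def nat_add_distrib add.commute)
qed (use assms in \<open>simp add: Rz_def\<close>)

lemma to_k_Rz: "r \<in> Rz j \<Longrightarrow> j > 0 \<Longrightarrow> tk r = 0"
  using to_k_graded[of r "nat j"] by (simp add: Rz_def)

text \<open>In positive degree the cofactors lie one degree lower; for \<open>j \<le> 0\<close> the
  element is a constant without augmentation, hence 0. Integer indices allow for negative internal
  degrees in the basis of \<open>F\<close>.\<close>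

lemma Rz_expansion:
  assumes "r \<in> Rz j" "tk r = 0"
  shows "\<exists>a. r = (\<Sum>i\<in>UNIV. X i * a i) \<and> (\<forall>i. a i \<in> Rz (j - 1))"
proof (cases "j > 0")
  case True
  then have "r \<in> R_graded \<pi> (Suc (nat (j - 1)))"
    using assms(1) by (simp add: Rz_def Suc_nat_eq_nat_zadd1)
  then obtain a where "r = (\<Sum>i\<in>UNIV. X i * a i)" "\<And>i. a i \<in> R_graded \<pi> (nat (j - 1))"
    by (rule maximal_expansion_graded) blast
  then show ?thesis
    using True by (intro exI[of _ a]) (simp add: Rz_def)
next
  case False
  then have "r = 0"
    using assms graded_0_eq[of r] by (auto simp: Rz_def split: if_splits)
  then show ?thesis
    by (intro exI[of _ "\<lambda>_. 0"]) simp
qed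

lemma lin_Rz:
  assumes "\<And>b. hdeg F b = i \<Longrightarrow> \<phi> b \<in> Rz (ideg F b + c)" and v: "v \<in> F_graded \<pi> F i j"
  shows "lin (*) \<phi> v \<in> Rz (j + c)"
  unfolding lin_def
proof (rule Rz_sum)
  fix b assume bv: "b \<in> keys v"
  obtain e where e: "ideg F b + int e = j" "lookup v b \<in> R_graded \<pi> e" and b: "hdeg F b = i"
    using bv v by (auto simp: F_graded_def F_term_def)
  have "lookup v b * \<phi> b \<in> Rz (ideg F b + c + int e)"
    by (rule Rz_mult[OF e(2) assms(1)[OF b]])
  then show "lookup v b * \<phi> b \<in> Rz (j + c)"
    by (simp add: e(1)[symmetric] add.commute add.left_commute)
qed

lemma F_graded_iff: "v \<in> F_graded \<pi> F p q \<longleftrightarrow> Fproj {(p, q)} v = v"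
  by (metis Fproj_graded Fproj_in_graded singletonI)

lemma F_graded_sum: "(\<And>a. a \<in> A \<Longrightarrow> f a \<in> F_graded \<pi> F p q) \<Longrightarrow> (\<Sum>a\<in>A. f a) \<in> F_graded \<pi> F p q"
  by (simp add: F_graded_iff Fproj_sum)

lemma form_t_0: "R_form \<pi> f \<Longrightarrow> t v = 0 \<Longrightarrow> f (v :: 'b \<Rightarrow>\<^sub>0 'r) = 0"
  using fbar_t[of f v] module_hom.zero[OF module_hom_fbar, of f] by simp

lemma aug_form: "R_form \<pi> aug"
  using aug.module_hom_axioms by (simp add: R_form_def)

lemma aug_scale: "aug (free_scale r v) = tk r * aug v"
  by (simp add: aug.scale k_scale_def)

section \<open>Images in \<open>F\<close> of the basis of the minimal resolution\<close>

definition unit :: "'b \<Rightarrow>\<^sub>0 'r"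
  where "unit = (SOME \<epsilon>. \<epsilon> \<in> F_graded \<pi> F 0 0 \<and> aug \<epsilon> = 1)"

lemma unit_graded: "unit \<in> F_graded \<pi> F 0 0" and aug_unit [simp]: "aug unit = 1"
  using someI_ex[OF ex_unit] by (simp_all add: unit_def)

lemma d_unit [simp]: "d unit = 0"
  by (intro d_term_0 F_graded_term[OF unit_graded])

text \<open>Subtracting a multiple of the cycle \<open>unit\<close> adjusts the augmentation of a
  preimage without changing its boundary.\<close>

lemma exact_aug:
  assumes "d u = 0" "aug u = 0"
  shows "\<exists>w. d w = u \<and> aug w = 0"
proof -
  from assms obtain w where "d w = u" by (rule exact)
  then show ?thesis
    by (intro exI[of _ "w - free_scale (const (aug w)) unit"])
      (simp add: d.diff d.scale aug.diff aug_scale)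
qed

lemma ex_gen1: "\<exists>y. y \<in> F_graded \<pi> F 1 1 \<and> d y = free_scale (X i) unit"
proof -
  have "free_scale (X i) unit \<in> F_graded \<pi> F 0 1"
    using F_graded_scale[OF X_graded unit_graded] by simp
  moreover obtain w where "d w = free_scale (X i) unit"
    using exact[of "free_scale (X i) unit"] by (auto simp: d.scale aug_scale)
  ultimately have "d (Fproj {(1, 1)} w) = free_scale (X i) unit"
    by (simp add: d_Fproj Fproj_graded)
  then show ?thesis using Fproj_in_graded by blast
qed

definition gen1 :: "'x \<Rightarrow> ('b \<Rightarrow>\<^sub>0 'r)"
  where "gen1 i = (SOME y. y \<in> F_graded \<pi> F 1 1 \<and> d y = free_scale (X i) unit)"

lemma gen1_graded: "gen1 i \<in> F_graded \<pi> F 1 1" and d_gen1: "d (gen1 i) = free_scale (X i) unit"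
  using someI_ex[OF ex_gen1] by (simp_all add: gen1_def)

lemma aug_gen1 [simp]: "aug (gen1 i) = 0"
  using aug_graded_eq_0[OF gen1_graded] by simp

section \<open>Coordinates of the comparison map to the minimal resolution\<close>

definition coeff0 :: "('b \<Rightarrow>\<^sub>0 'r) \<Rightarrow> 'r"
  where "coeff0 = lin (*) (\<lambda>b. const (aug (basis b)))"

sublocale coeff0: module_hom free_scale "(*)" coeff0
  unfolding coeff0_def by (rule rmod.module_hom_lin)

lemma to_k_coeff0 [simp]: "tk (coeff0 v) = aug v"
proof (induction v rule: poly_mapping_additive_induct)
  case (single b r)
  have "aug (single b r) = tk r * aug (basis b)"
    using aug_scale[of r "basis b"] by (simp add: free_scale_single)
  then show ?case
    by (simp add: coeff0_def rmod.lin_single to_k_mult)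
qed (simp add: coeff0.add to_k_add aug.add)

lemma coeff0_graded: "v \<in> F_graded \<pi> F 0 j \<Longrightarrow> coeff0 v \<in> Rz j"
proof -
  have "const (aug (basis b)) \<in> Rz (ideg F b + 0)" if "hdeg F b = 0" for b
    using aug_graded_eq_0[OF basis_graded, of b] that
    by (cases "ideg F b = 0") (auto simp: Rz_def)
  then show "v \<in> F_graded \<pi> F 0 j \<Longrightarrow> coeff0 v \<in> Rz j"
    using lin_Rz[of 0 "\<lambda>b. const (aug (basis b))" 0 v j] by (simp add: coeff0_def)
qed

text \<open>Cofactors exist because \<open>coeff0 (d (basis b))\<close> has augmentation
  \<open>aug (d (basis b)) = 0\<close>. The degree condition makes the comparison map homogeneous;
  the default 0 confines it to \<open>F_1\<close>.\<close>

definition coords :: "'b \<Rightarrow> 'x \<Rightarrow> 'r"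
  where "coords b = (if hdeg F b = 1 then SOME a. coeff0 (d (basis b)) = (\<Sum>i\<in>UNIV. X i * a i)
    \<and> (\<forall>i. a i \<in> Rz (ideg F b - 1)) else (\<lambda>_. 0))"

lemma coords:
  assumes "hdeg F b = 1"
  shows "coeff0 (d (basis b)) = (\<Sum>i\<in>UNIV. X i * coords b i) \<and> (\<forall>i. coords b i \<in> Rz (ideg F b - 1))"
proof -
  have "d (basis b) \<in> F_graded \<pi> F 0 (ideg F b)"
    using basis_graded[of b] assms by (intro d_graded_Suc) simp
  then have "coeff0 (d (basis b)) \<in> Rz (ideg F b)"
    by (rule coeff0_graded)
  from someI_ex[OF Rz_expansion[OF this]] assms show ?thesis
    by (simp add: coords_def)
qed

definition coeff1 :: "'x \<Rightarrow> ('b \<Rightarrow>\<^sub>0 'r) \<Rightarrow> 'r"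
  where "coeff1 i = lin (*) (\<lambda>b. coords b i)"

sublocale coeff1: module_hom free_scale "(*)" "coeff1 i" for i
  unfolding coeff1_def by (rule rmod.module_hom_lin)

lemma coeff1_graded: "v \<in> F_graded \<pi> F 1 j \<Longrightarrow> coeff1 i v \<in> Rz (j - 1)"
  using lin_Rz[of 1 "\<lambda>b. coords b i" "-1" v j] coords by (simp add: coeff1_def)

text \<open>The chain map condition. It holds on all of \<open>F\<close> because both sides vanish
  outside \<open>F_1\<close>.\<close>

lemma sum_coeff1: "(\<Sum>i\<in>UNIV. X i * coeff1 i v) = coeff0 (d v)"
proof (induction v rule: poly_mapping_additive_induct)
  case (single b r)
  have "coeff0 (d (single b r)) = r * coeff0 (d (basis b))"
    using coeff0.scale[of r "d (basis b)"] by (simp add: free_scale_single flip: d.scale)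
  moreover have "(\<Sum>i\<in>UNIV. X i * coords b i) = coeff0 (d (basis b))"
  proof (cases "hdeg F b = 1")
    case True
    then show ?thesis using coords by simp
  next
    case False
    then have "coeff0 (d (basis b)) = 0"
    proof (cases "hdeg F b")
      case 0
      then show ?thesis using basis_term[of b] by (simp add: d_term_0)
    next
      case (Suc n)
      with False obtain m where m: "hdeg F b = Suc (Suc m)" by (cases n) auto
      then have "d (basis b) \<in> F_term F (Suc m)"
        using basis_term[of b] by (intro d_term) simp
      then have "aug (basis b') = 0" if "b' \<in> keys (d (basis b))" for b'
        using that aug_term[OF basis_term, of b'] by (simp add: F_term_def)
      then show ?thesis
        by (simp add: coeff0_def lin_def)
    qed
    then show ?thesis using False by (simp add: coords_def)
  qed
  ultimately show ?case
    by (simp add: coeff1_def rmod.lin_single sum_distrib_left[symmetric] mult.left_commute)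
qed (simp add: coeff1.add coeff0.add d.add distrib_left sum.distrib)

section \<open>Homotopy between the identity and the composite of the comparison maps\<close>

lemma module_hom_diff:
  assumes "module_hom free_scale free_scale \<phi>" "module_hom free_scale free_scale \<psi>"
  shows "module_hom free_scale free_scale (\<lambda>v :: 'b \<Rightarrow>\<^sub>0 'r. \<phi> v - \<psi> v :: 'b \<Rightarrow>\<^sub>0 'r)"
  by (rule module_pair.module_hom_sub[OF module_pair.intro[OF module_free_scale module_free_scale] assms])

lemma module_hom_coeff:
  assumes "module_hom free_scale (*) \<phi>"
  shows "module_hom free_scale free_scale (\<lambda>v :: 'b \<Rightarrow>\<^sub>0 'r. free_scale (\<phi> v) (w :: 'b \<Rightarrow>\<^sub>0 'r))"
proof -
  interpret \<phi>: module_hom free_scale "(*)" \<phi> by (fact assms)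
  show ?thesis
    by unfold_locales (simp_all add: \<phi>.add \<phi>.scale free.scale_left_distrib)
qed

text \<open>The condition \<open>aug w = 0\<close> ensures that elements formed with
  \<open>htpy0\<close> keep augmentation 0 and can be lifted along \<open>d\<close> by exactness of
  the total complex.\<close>

definition htpy0 :: "('b \<Rightarrow>\<^sub>0 'r) \<Rightarrow> ('b \<Rightarrow>\<^sub>0 'r)"
  where "htpy0 = lin free_scale (\<lambda>b. if hdeg F b = 0
    then SOME w. d w = basis b - free_scale (coeff0 (basis b)) unit \<and> aug w = 0 else 0)"

sublocale htpy0: module_hom free_scale free_scale htpy0
  unfolding htpy0_def by (rule free.module_hom_lin)

lemma htpy0_basis:
  assumes "hdeg F b = 0"
  shows "d (htpy0 (basis b)) = basis b - free_scale (coeff0 (basis b)) unit \<and> aug (htpy0 (basis b)) = 0"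
proof -
  have "d (basis b) = 0"
    using basis_term[of b] assms by (simp add: d_term_0)
  then have "\<exists>w. d w = basis b - free_scale (coeff0 (basis b)) unit \<and> aug w = 0"
    by (intro exact_aug) (simp_all add: d.diff d.scale aug.diff aug_scale)
  from someI_ex[OF this] assms show ?thesis
    by (simp add: htpy0_def free.lin_single)
qed

lemma aug_htpy0 [simp]: "aug (htpy0 v) = 0"
proof -
  have "R_form \<pi> (aug \<circ> htpy0)"
    unfolding R_form_def by (rule module_hom_compose[OF htpy0.module_hom_axioms aug.module_hom_axioms])
  moreover have "(aug \<circ> htpy0) (basis b) = 0" for b
    using htpy0_basis[of b] by (cases "hdeg F b = 0") (auto simp: htpy0_def free.lin_single)
  ultimately have "(aug \<circ> htpy0) v = 0"
    using form_keys[of "aug \<circ> htpy0" v] by blast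
  then show ?thesis by simp
qed

lemma d_htpy0: "v \<in> F_term F 0 \<Longrightarrow> d (htpy0 v) = v - free_scale (coeff0 v) unit"
  using free.hom_eqI[OF module_hom_compose[OF htpy0.module_hom_axioms d.module_hom_axioms]
      module_hom_diff[OF free.module_hom_ident module_hom_coeff[OF coeff0.module_hom_axioms]], of v unit]
    htpy0_basis by (simp add: F_term_def)

definition defect :: "('b \<Rightarrow>\<^sub>0 'r) \<Rightarrow> ('b \<Rightarrow>\<^sub>0 'r)"
  where "defect v = v - (\<Sum>i\<in>UNIV. free_scale (coeff1 i v) (gen1 i)) - htpy0 (d v)"

lemma module_hom_defect: "module_hom free_scale free_scale defect"
  unfolding defect_def
proof (intro module_hom_diff free.module_hom_ident)
  show "module_hom free_scale free_scale (\<lambda>v. \<Sum>i\<in>UNIV. free_scale (coeff1 i v) (gen1 i))"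
    by (rule module_pair.module_hom_sum[OF module_pair.intro[OF module_free_scale module_free_scale]
        module_hom_coeff[OF coeff1.module_hom_axioms]]) (simp add: module_free_scale)
  show "module_hom free_scale free_scale (\<lambda>v. htpy0 (d v))"
    using module_hom_compose[OF d.module_hom_axioms htpy0.module_hom_axioms] by (simp add: o_def)
qed

lemma d_defect:
  assumes "v \<in> F_term F 1"
  shows "d (defect v) = 0"
proof -
  have "d (\<Sum>i\<in>UNIV. free_scale (coeff1 i v) (gen1 i)) = free_scale (\<Sum>i\<in>UNIV. X i * coeff1 i v) unit"
    by (simp add: d.sum d.scale d_gen1 free.scale_sum_left mult.commute)
  moreover have "d (htpy0 (d v)) = d v - free_scale (coeff0 (d v)) unit"
    using assms by (intro d_htpy0 d_term) simp
  ultimately show ?thesis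
    by (simp add: defect_def d.diff sum_coeff1)
qed

definition htpy1 :: "('b \<Rightarrow>\<^sub>0 'r) \<Rightarrow> ('b \<Rightarrow>\<^sub>0 'r)"
  where "htpy1 = lin free_scale (\<lambda>b. if hdeg F b = 1 then SOME w. d w = defect (basis b) else 0)"

sublocale htpy1: module_hom free_scale free_scale htpy1
  unfolding htpy1_def by (rule free.module_hom_lin)

lemma htpy1_basis:
  assumes "hdeg F b = 1"
  shows "d (htpy1 (basis b)) = defect (basis b)"
proof -
  have b: "basis b \<in> F_term F 1"
    using basis_term[of b] assms by simp
  then have "aug (defect (basis b)) = 0"
    using aug_term[OF b] by (simp add: defect_def aug.diff aug.sum aug_scale)
  then have "\<exists>w. d w = defect (basis b)"
    using exact[OF d_defect[OF b]] by blast
  from someI_ex[OF this] assms show ?thesis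
    by (simp add: htpy1_def free.lin_single)
qed

lemma homotopy:
  assumes "v \<in> F_term F 1"
  shows "v = (\<Sum>i\<in>UNIV. free_scale (coeff1 i v) (gen1 i)) + htpy0 (d v) + d (htpy1 v)"
proof -
  have "d (htpy1 v) = defect v"
    using free.hom_eqI[OF module_hom_compose[OF htpy1.module_hom_axioms d.module_hom_axioms]
        module_hom_defect, of v] htpy1_basis assms by (simp add: F_term_def)
  then show ?thesis by (simp add: defect_def)
qed

section \<open>The first two Tor modules\<close>

text \<open>Reduce the homotopy formula to \<open>F \<otimes> k\<close>: the coordinates have
  positive degree \<open>j - 1\<close> and vanish, the term with \<open>htpy0\<close> vanishes
  because \<open>d v\<close> reduces to 0, and a boundary is left.\<close>

lemma Tor_1_degree:
  assumes "j > 1"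
  shows "\<not> Tor_nonzero \<pi> F 1 j"
proof
  assume "Tor_nonzero \<pi> F 1 j"
  then obtain x where x: "keys x \<subseteq> bideg 1 j" "D x = 0" "x \<notin> range D"
    by (auto simp: Tor_nonzero_iff)
  define v where "v = lift x"
  have v: "v \<in> F_graded \<pi> F 1 j" "t v = x"
    using lift_graded[OF x(1)] by (simp_all add: v_def)
  have td: "t (d v) = 0"
    by (simp add: t_d v(2) x(2))
  have "tk (coeff1 i v) = 0" for i
    using to_k_Rz[OF coeff1_graded[OF v(1)]] assms by simp
  then have "t v = t (d (htpy1 v))"
    using arg_cong[OF homotopy[OF F_graded_term[OF v(1)]], of t]
      t_hom_eq_0[OF htpy0.module_hom_axioms td]
    by (simp add: t_add t_sum t_scale)
  then show False
    using x(3) v(2) by (simp add: t_d)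
qed

text \<open>The coordinates of \<open>u = d v\<close> give an element of \<open>I\<close> of degree
  \<open>j\<close>, by hypothesis in \<open>mI\<close>. Correcting them by elements of
  \<open>I\<close> yields a syzygy of the variables with entries of degree
  \<open>j - 1 \<ge> 2\<close>, hence a combination of syzygies with the variables as coefficients.
  Lifting these turns \<open>v\<close> into a cycle of \<open>F\<close>, hence a boundary, without
  changing its reduction.\<close>

lemma Tor_2_degree:
  assumes j: "j > 2" and gen: "\<And>f. f \<in> I \<Longrightarrow> homogeneous (nat j) f \<Longrightarrow> f \<in> mI"
  shows "\<not> Tor_nonzero \<pi> F 2 j"
proof
  assume "Tor_nonzero \<pi> F 2 j"
  then obtain x where x: "keys x \<subseteq> bideg 2 j" "D x = 0" "x \<notin> range D"
    by (auto simp: Tor_nonzero_iff)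
  define v where "v = lift x"
  have v: "v \<in> F_graded \<pi> F 2 j" "t v = x"
    using lift_graded[OF x(1)] by (simp_all add: v_def)
  define u where "u = d v"
  have u: "u \<in> F_graded \<pi> F 1 j"
    using v(1) d_graded_Suc[of v 1 j] by (simp add: u_def numeral_2_eq_2)
  have tu: "t u = 0"
    by (simp add: u_def t_d v(2) x(2))
  define e where "e = nat (j - 1)"
  have e: "nat j = Suc e" "e \<ge> 2" using j by (auto simp: e_def)
  have "coeff1 i u \<in> R_graded \<pi> e" for i
    using coeff1_graded[OF u, of i] j by (simp add: Rz_def e_def)
  then have "\<exists>s. \<pi> s = coeff1 i u \<and> homogeneous e s" for i
    by (metis R_gradedE)
  then obtain s where s: "\<And>i. \<pi> (s i) = coeff1 i u" "\<And>i. homogeneous e (s i)" by metis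
  define f where "f = (\<Sum>i\<in>UNIV. mvar i * s i)"
  have f_hom: "homogeneous (Suc e) f"
    unfolding f_def using homogeneous_mult[OF homogeneous_mvar s(2)] by (intro homogeneous_sum) simp
  have "\<pi> f = coeff0 (d u)"
    by (simp add: f_def \<pi>_sum \<pi>_mult s(1) sum_coeff1 flip: X_def)
  then have "f \<in> I"
    by (simp add: u_def \<pi>_eq_0_iff[symmetric] coeff0.zero)
  then have "f \<in> mI"
    using gen f_hom e(1) by simp
  then obtain q where q: "f = (\<Sum>i\<in>UNIV. mvar i * q i)" "\<And>i. q i \<in> I"
    by (auto simp: irrelevant_times_def)
  \<comment> \<open>Only the degree \<open>e\<close> parts matter; with them
    \<open>s i - q' i\<close> is homogeneous of degree \<open>e\<close>, so its order is at least
    2.\<close>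
  define q' where "q' = (\<lambda>i. hproj {e} (q i))"
  have q': "q' i \<in> I" "homogeneous e (q' i)" for i
    unfolding q'_def by (intro hproj_I q(2) homogeneous_hproj)+
  have "f = hproj {Suc e} f"
    using f_hom by (simp add: hcomp_homogeneous)
  also have "\<dots> = (\<Sum>i\<in>UNIV. mvar i * q' i)"
    unfolding q(1) prestrict_sum hproj_mvar_mult q'_def by (simp only: nat.case)
  finally have "(\<Sum>i\<in>UNIV. mvar i * (s i - q' i)) = 0"
    by (simp add: right_diff_distrib sum_subtractf f_def)
  moreover have "homogeneous e (s i - q' i)" for i
    by (intro homogeneous_minus s(2) q'(2))
  ultimately have "m_syzygy (\<lambda>i. s i - q' i)"
    using e(2) by (intro m_syzygy_of_order_ge_2) (auto simp: homogeneous_iff)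
  then obtain z where z: "\<And>l. (\<Sum>i\<in>UNIV. mvar i * z l i) = 0"
    "\<And>i. s i - q' i = (\<Sum>l\<in>UNIV. mvar l * z l i)"
    by (auto simp: m_syzygy_def)
  have coeff1_u: "coeff1 i u = (\<Sum>l\<in>UNIV. X l * \<pi> (z l i))" for i
  proof -
    have "coeff1 i u = \<pi> (s i - q' i)"
      using q'(1) by (simp add: \<pi>_diff s(1) \<pi>_eq_0_iff[symmetric])
    then show ?thesis by (simp add: z(2) \<pi>_sum \<pi>_mult X_def)
  qed
  define y where "y = (\<lambda>l. \<Sum>i\<in>UNIV. free_scale (\<pi> (z l i)) (gen1 i))"
  have "d (y l) = free_scale (\<pi> (\<Sum>i\<in>UNIV. mvar i * z l i)) unit" for l
    by (simp add: y_def d.sum d.scale d_gen1 free.scale_sum_left \<pi>_sum \<pi>_mult X_def mult.commute)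
  then have dy: "d (y l) = 0" for l
    by (simp add: z(1))
  have "aug (y l) = 0" for l
    by (simp add: y_def aug.sum aug_scale)
  with dy have "\<exists>w. d w = y l \<and> aug w = 0" for l
    by (intro exact_aug)
  then obtain w where w: "\<And>l. d (w l) = y l" "\<And>l. aug (w l) = 0" by metis
  have "(\<Sum>i\<in>UNIV. free_scale (coeff1 i u) (gen1 i))
      = (\<Sum>i\<in>UNIV. \<Sum>l\<in>UNIV. free_scale (X l) (free_scale (\<pi> (z l i)) (gen1 i)))"
    by (simp add: coeff1_u free.scale_sum_left)
  also have "\<dots> = (\<Sum>l\<in>UNIV. free_scale (X l) (y l))"
    by (subst sum.swap) (simp only: y_def free.scale_sum_right)
  finally have sum_y: "(\<Sum>i\<in>UNIV. free_scale (coeff1 i u) (gen1 i)) = (\<Sum>l\<in>UNIV. free_scale (X l) (y l))" .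
  \<comment> \<open>Both corrections reduce to 0. By the homotopy formula the boundary that remains
    is \<open>htpy0 (d u)\<close>, which is 0 since \<open>u\<close> is itself a boundary.\<close>
  define v' where "v' = v - (\<Sum>l\<in>UNIV. free_scale (X l) (w l)) - htpy1 u"
  have "d v' = 0"
    using homotopy[OF F_graded_term[OF u]]
    by (simp add: v'_def d.diff d.sum d.scale w(1) sum_y flip: u_def)
      (simp add: u_def htpy0.zero algebra_simps)
  moreover have th: "t (htpy1 u) = 0"
    by (rule t_hom_eq_0[OF htpy1.module_hom_axioms tu])
  then have "aug v' = 0"
    using aug_graded_eq_0[OF v(1)] form_t_0[OF aug_form]
    by (simp add: v'_def aug.diff aug.sum aug_scale)
  ultimately obtain w' where "d w' = v'" by (rule exact)
  then have "t v' = D (t w')"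
    using t_d by metis
  moreover have "t v' = x"
    by (simp add: v'_def t_diff t_sum t_scale th v(2))
  ultimately show False using x(3) by simp
qed

text \<open>Cofactors of \<open>g\<close> along the variables give a cycle \<open>y = d v\<close> in
  \<open>F_1\<close>, and \<open>v\<close> is a Tor cycle since the cofactors have positive degree.
  Were its class 0, \<open>y\<close> would combine boundaries with the variables as coefficients; in
  coordinates this puts \<open>\<rho> * g\<close> into \<open>mI\<close> for some
  \<open>\<rho>\<close> of constant term 1.\<close>

lemma Tor_2_nonzero:
  assumes g: "g \<in> I" "homogeneous e g" "g \<notin> mI"
  shows "Tor_nonzero \<pi> F 2 (int e)"
proof -
  have "g \<noteq> 0" using g(3) rmod.subspace_0[OF subspace_mI] by blast
  then obtain m where "m \<in> keys g"
    by (metis keys_eq_empty all_not_in_conv)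
  then have "e \<ge> 2" using I_order[OF g(1)] g(2) by (auto simp: homogeneous_iff)
  then obtain e' where e: "e = Suc e'" "e' \<ge> 1" by (metis Suc_le_D Suc_le_mono numeral_2_eq_2 One_nat_def)
  obtain s where s: "g = (\<Sum>i\<in>UNIV. mvar i * s i)" "\<And>i. homogeneous e' (s i)"
    using irrelevant_expansion[of g] I_lookup_0[OF g(1)] g(2) e(1) by metis
  have s0: "lookup (s i) 0 = 0" for i
    using homogeneous_lookup_zero[OF s(2)] e(2) by simp
  define y where "y = (\<Sum>i\<in>UNIV. free_scale (\<pi> (s i)) (gen1 i))"
  have y: "y \<in> F_graded \<pi> F 1 (int e)"
    unfolding y_def using F_graded_scale[OF R_gradedI[OF s(2)] gen1_graded]
    by (intro F_graded_sum) (simp add: e(1))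
  have "d y = free_scale (\<pi> g) unit"
    by (simp add: s(1) y_def d.sum d.scale d_gen1 free.scale_sum_left \<pi>_sum \<pi>_mult X_def mult.commute)
  then have "d y = 0"
    using g(1) by (simp add: \<pi>_eq_0_iff[symmetric])
  moreover have "aug y = 0"
    using aug_graded_eq_0[OF y] by simp
  ultimately obtain w0 where w0: "d w0 = y" by (rule exact)
  define v where "v = Fproj {(2, int e)} w0"
  have v: "v \<in> F_graded \<pi> F 2 (int e)"
    unfolding v_def by (rule Fproj_in_graded)
  have dv: "d v = y"
    by (simp add: v_def d_Fproj w0 Fproj_graded[OF y])
  have "D (t v) = 0"
    by (simp add: t_d[symmetric] dv y_def t_sum t_scale s0)
  moreover have "t v \<notin> range D"
  proof
    assume "t v \<in> range D"
    then obtain x' where "t v = D x'" by blast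
    then have "t (v - d (lift x')) = 0"
      by (simp add: t_diff t_d)
    then obtain w where w: "v - d (lift x') = (\<Sum>l\<in>UNIV. free_scale (X l) (w l))"
      by (rule t_eq_0_expansion)
    have "y = d (v - d (lift x'))"
      by (simp add: d.diff dv)
    then have y_eq: "y = (\<Sum>l\<in>UNIV. free_scale (X l) (d (w l)))"
      by (simp add: w d.sum d.scale)
    \<comment> \<open>The comparison maps compose to the identity only up to homotopy, so the
      composite is carried along, as the matrix \<open>A\<close> in degree 1 and the factor
      \<open>\<rho>\<close> in degree 0.\<close>
    define A where "A = (\<lambda>i k. inv \<pi> (coeff1 i (gen1 k)))"
    define W where "W = (\<lambda>i l. inv \<pi> (coeff1 i (d (w l))))"
    have A: "coeff1 i (gen1 k) = \<pi> (A i k)" and W: "coeff1 i (d (w l)) = \<pi> (W i l)" for i k l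
      by (simp_all add: A_def W_def surj_f_inv_f[OF surj_\<pi>])
    obtain \<rho> where \<rho>: "coeff0 unit = \<pi> \<rho>"
      by (metis \<pi>_cases)
    have "lookup \<rho> 0 = 1"
      using to_k_coeff0[of unit] by (simp add: \<rho> del: to_k_coeff0)
    have 1: "(\<Sum>i\<in>UNIV. mvar i * W i l) \<in> I" for l
    proof -
      have "\<pi> (\<Sum>i\<in>UNIV. mvar i * W i l) = coeff0 (d (d (w l)))"
        by (simp add: \<pi>_sum \<pi>_mult sum_coeff1 del: d_d flip: X_def W)
      then show ?thesis by (simp add: coeff0.zero \<pi>_eq_0_iff[symmetric])
    qed
    have 2: "(\<Sum>i\<in>UNIV. mvar i * A i k) - mvar k * \<rho> \<in> I" for k
    proof -
      have "\<pi> (\<Sum>i\<in>UNIV. mvar i * A i k) = coeff0 (d (gen1 k))"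
        by (simp add: \<pi>_sum \<pi>_mult flip: X_def A sum_coeff1)
      then show ?thesis
        by (simp add: d_gen1 coeff0.scale \<rho> \<pi>_diff \<pi>_mult X_def flip: \<pi>_eq_0_iff)
    qed
    have 3: "(\<Sum>k\<in>UNIV. s k * A i k) - (\<Sum>l\<in>UNIV. mvar l * W i l) \<in> I" for i
    proof -
      have "\<pi> (\<Sum>k\<in>UNIV. s k * A i k) = coeff1 i y"
        by (simp add: y_def coeff1.sum coeff1.scale A \<pi>_sum \<pi>_mult)
      moreover have "\<pi> (\<Sum>l\<in>UNIV. mvar l * W i l) = coeff1 i y"
        by (simp add: y_eq coeff1.sum coeff1.scale W \<pi>_sum \<pi>_mult X_def)
      ultimately show ?thesis by (simp add: \<pi>_diff flip: \<pi>_eq_0_iff)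
    qed
    have x0: "lookup (mvar i) 0 = 0" for i :: 'x
      by (rule homogeneous_lookup_zero[OF homogeneous_mvar]) simp
    \<comment> \<open>The three families of elements of \<open>I\<close> are multiplied by variables
      or by the \<open>s k\<close>, all without constant term; the products with \<open>A\<close>
      and with \<open>W\<close> cancel.\<close>
    have "(\<Sum>i\<in>UNIV. mvar i * ((\<Sum>k\<in>UNIV. s k * A i k) - (\<Sum>l\<in>UNIV. mvar l * W i l)))
        + (\<Sum>l\<in>UNIV. mvar l * (\<Sum>i\<in>UNIV. mvar i * W i l))
        - (\<Sum>k\<in>UNIV. s k * ((\<Sum>i\<in>UNIV. mvar i * A i k) - mvar k * \<rho>)) \<in> mI"
      by (intro rmod.subspace_add[OF subspace_mI] rmod.subspace_diff[OF subspace_mI]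
          rmod.subspace_sum[OF subspace_mI] mult_mI 1 2 3 x0 s0)
    also have "(\<Sum>i\<in>UNIV. mvar i * ((\<Sum>k\<in>UNIV. s k * A i k) - (\<Sum>l\<in>UNIV. mvar l * W i l)))
        + (\<Sum>l\<in>UNIV. mvar l * (\<Sum>i\<in>UNIV. mvar i * W i l))
        - (\<Sum>k\<in>UNIV. s k * ((\<Sum>i\<in>UNIV. mvar i * A i k) - mvar k * \<rho>)) = \<rho> * g"
    proof -
      have "(\<Sum>i\<in>UNIV. mvar i * (\<Sum>k\<in>UNIV. s k * A i k)) = (\<Sum>k\<in>UNIV. s k * (\<Sum>i\<in>UNIV. mvar i * A i k))"
        unfolding sum_distrib_left by (subst sum.swap) (simp add: mult.left_commute)
      moreover have "(\<Sum>i\<in>UNIV. mvar i * (\<Sum>l\<in>UNIV. mvar l * W i l)) = (\<Sum>l\<in>UNIV. mvar l * (\<Sum>i\<in>UNIV. mvar i * W i l))"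
        unfolding sum_distrib_left by (subst sum.swap) (simp add: mult.left_commute)
      moreover have "(\<Sum>k\<in>UNIV. s k * (mvar k * \<rho>)) = \<rho> * g"
        by (simp add: s(1) sum_distrib_left mult.commute mult.left_commute)
      ultimately show ?thesis
        by (simp add: right_diff_distrib sum_subtractf)
    qed
    finally have "\<rho> * g \<in> mI" .
    moreover have "(\<rho> - 1) * g \<in> mI"
      using g(1) \<open>lookup \<rho> 0 = 1\<close> by (intro mult_mI) (simp_all add: lookup_minus lookup_one)
    ultimately have "\<rho> * g - (\<rho> - 1) * g \<in> mI"
      by (rule rmod.subspace_diff[OF subspace_mI])
    then show False
      using g(3) by (simp add: left_diff_distrib)
  qed
  ultimately show ?thesis
    using keys_t[OF v] by (auto simp: Tor_nonzero_iff)
qed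

end

section \<open>Rate and slant\<close>

text \<open>
  The largest internal degree of a product of total cohomological degree \<open>i\<close>, if its factors have
  cohomological degrees 1 and 2 and internal degrees at most 1 and \<open>M \<ge> 2\<close> respectively.
\<close>

definition Bd :: "nat \<Rightarrow> nat \<Rightarrow> int"
  where "Bd M i = int (i div 2 * M + i mod 2)"

text \<open>Quotients and remainders simply add unless both arguments are odd; then two remainders 1
  are replaced by one \<open>M \<ge> 2\<close>.\<close>

lemma Bd_superadditive:
  assumes "M \<ge> 2"
  shows "Bd M i + Bd M j \<le> Bd M (i + j)"
proof -
  have "i div 2 * M + i mod 2 + (j div 2 * M + j mod 2) \<le> (i + j) div 2 * M + (i + j) mod 2"
  proof (cases "odd i \<and> odd j")
    case True
    then obtain k l where "i = Suc (2 * k)" "j = Suc (2 * l)"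
      by (metis oddE Suc_eq_plus1)
    moreover from this have "(i + j) div 2 = Suc (k + l)" "(i + j) mod 2 = 0" "i div 2 = k" "j div 2 = l"
      by (auto simp: mod_eq_0_iff_dvd)
    ultimately show ?thesis
      using assms by (simp add: algebra_simps)
  next
    case False
    then have "(i + j) div 2 = i div 2 + j div 2" "(i + j) mod 2 = i mod 2 + j mod 2"
      by presburger+
    then show ?thesis by (simp add: algebra_simps)
  qed
  then show ?thesis unfolding Bd_def by linarith
qed

lemma Bd_slant: "M \<ge> 2 \<Longrightarrow> real_of_int (Bd M i) \<le> real M / 2 * real i"
proof -
  assume M: "M \<ge> 2"
  have "2 * (i div 2 * M + i mod 2) = M * (2 * (i div 2)) + 2 * (i mod 2)"
    by simp
  also have "\<dots> \<le> M * (2 * (i div 2)) + M * (i mod 2)"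
    using M by simp
  also have "\<dots> = M * i"
    unfolding distrib_left[symmetric] by simp
  finally have "2 * (i div 2 * M + i mod 2) \<le> M * i" .
  then have "real (2 * (i div 2 * M + i mod 2)) \<le> real (M * i)"
    by (simp only: of_nat_le_iff)
  then show ?thesis by (simp add: Bd_def)
qed

text \<open>With \<open>i = 2 * k + r\<close> the difference of the two sides is
  \<open>(k - 1) * (M - 2)\<close> for \<open>r = 0\<close> and \<open>k * (M - 2)\<close> for
  \<open>r = 1\<close>.\<close>

lemma Bd_rate:
  assumes "M \<ge> 2" "i \<ge> 2"
  shows "real_of_int (Bd M i) - 1 \<le> (real M - 1) * (real i - 1)"
proof -
  define k r where "k = real (i div 2)" and "r = real (i mod 2)"
  have "real i = real (2 * (i div 2) + i mod 2)" by simp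
  then have i: "real i = 2 * k + r" by (simp only: k_def r_def of_nat_add of_nat_mult of_nat_numeral)
  have "i mod 2 = 0 \<or> i mod 2 = 1" by presburger
  then have r: "r = 0 \<or> r = 1" by (auto simp: r_def)
  have k: "k \<ge> 1" using assms(2) by (simp add: k_def)
  have M: "real M \<ge> 2" using assms(1) by simp
  have "0 \<le> (k - 1) * (real M - 2)" "0 \<le> k * (real M - 2)"
    using k M by simp_all
  with r have "k * real M + r - 1 \<le> (real M - 1) * (2 * k + r - 1)"
    by (auto simp: algebra_simps)
  then show ?thesis
    by (simp add: Bd_def i k_def r_def)
qed

section \<open>The degrees of minimal generators and the top degree of Tor_2\<close>

lemma (in resolution) max_gen_degree_le_t_deg: "max_gen_degree I \<le> t_deg \<pi> F 2"
  unfolding max_gen_degree_def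
proof (rule Sup_least)
  fix y assume "y \<in> {ereal (real e) |e G g. minimal_generators I G \<and> g \<in> G \<and> homogeneous e g}"
  then obtain e G g where y: "y = ereal (real e)" and G: "minimal_generators I G" "g \<in> G" "homogeneous e g"
    by blast
  then have "g \<in> I"
    using rmod.span_base[of g G] by (auto simp: minimal_generators_def)
  then have "Tor_nonzero \<pi> F 2 (int e)"
    using Tor_2_nonzero minimal_generator_not_mI[OF G(1,2)] G(3) by blast
  then show "y \<le> t_deg \<pi> F 2"
    unfolding t_deg_def y by (intro Sup_upper) force
qed

lemma (in resolution) Tor_2_le_max_gen_degree:
  assumes gen: "\<And>e G g. minimal_generators I G \<Longrightarrow> g \<in> G \<Longrightarrow> homogeneous e g \<Longrightarrow> e \<le> M"
    and "M \<ge> 2" "Tor_nonzero \<pi> F 2 j"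
  shows "j \<le> int M"
proof (rule ccontr)
  assume "\<not> j \<le> int M"
  then have j: "j > int M" by simp
  obtain G where G: "minimal_generators I G" using minimal_generators_exist by blast
  have "f \<in> mI" if "f \<in> I" "homogeneous (nat j) f" for f
  proof (rule high_degree_mI[OF G _ that])
    fix g e assume "g \<in> G" "homogeneous e g"
    then have "e \<le> M" using gen G by blast
    then show "e \<noteq> nat j" using j by simp
  qed
  then show False
    using Tor_2_degree[of j] j assms(2,3) by simp
qed

lemma (in resolution) ex_minimal_generator:
  assumes "I \<noteq> {0}"
  shows "\<exists>G g e. minimal_generators I G \<and> g \<in> G \<and> homogeneous e g \<and> e \<ge> 2"
proof -
  obtain G where G: "minimal_generators I G" using minimal_generators_exist by blast
  have "I \<subseteq> {0}" if "G \<subseteq> {0}"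
    using rmod.span_minimal[OF that rmod.subspace_single_0] G by (simp add: minimal_generators_def)
  then obtain g where g: "g \<in> G" "g \<noteq> 0"
    using assms rmod.subspace_0[OF subspace_I] by blast
  then obtain e where e: "homogeneous e g" using G by (auto simp: minimal_generators_def)
  obtain m where "m \<in> keys g"
    using g(2) by (metis keys_eq_empty all_not_in_conv)
  moreover have "g \<in> I"
    using G g(1) rmod.span_base[of g G] by (auto simp: minimal_generators_def)
  ultimately have "e \<ge> 2"
    using I_order e by (auto simp: homogeneous_iff)
  with G g e show ?thesis by blast
qed

theorem proposition2p4:
  fixes I :: "('x::finite, 'k::field) mpoly set"
    and \<pi> :: "('x, 'k) mpoly \<Rightarrow> 'r::comm_ring_1"
    and F :: "('r, 'b, 'k) free_complex"
  assumes "CARD('x) \<ge> 2"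
    and "homogeneous_ideal I" and "I \<noteq> {0}" and "I \<subseteq> irrelevant_ideal_sq"
    and "quotient_map I \<pi>"
    and "graded_free_resolution \<pi> F"
    and "Yoneda_subalgebra \<pi> F (Ext_deg \<pi> F 1 \<union> Ext_deg \<pi> F 2) = Ext \<pi> F"
  shows "rate \<pi> F = max_gen_degree I - 1 \<and> slant \<pi> F = max_gen_degree I / 2"
proof -
  interpret resolution I \<pi> F
    using assms by unfold_locales
  define S where "S = {e. \<exists>G g. minimal_generators I G \<and> g \<in> G \<and> homogeneous e g}"
  have m_eq: "max_gen_degree I = Sup ((\<lambda>e. ereal (real e)) ` S)"
    unfolding max_gen_degree_def S_def by (rule arg_cong[of _ _ Sup]) blast
  obtain e0 where e0: "e0 \<in> S" "e0 \<ge> 2"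
    using ex_minimal_generator[OF assms(3)] by (auto simp: S_def)
  have rate_ge: "(t_deg \<pi> F 2 - 1) / ereal (real 2 - 1) \<le> rate \<pi> F"
    unfolding rate_def by (rule SUP_upper) simp
  have slant_ge: "t_deg \<pi> F 2 / ereal (real 2) \<le> slant \<pi> F"
    unfolding slant_def by (rule SUP_upper) simp
  show ?thesis
  proof (cases "max_gen_degree I = \<infinity>")
    case True
    then have "t_deg \<pi> F 2 = \<infinity>"
      using max_gen_degree_le_t_deg by simp
    then show ?thesis
      using rate_ge slant_ge True by simp
  next
    case False
    \<comment> \<open>An infinite set of natural numbers is unbounded and would make the supremum
      infinite.\<close>
    have "finite S"
    proof (rule ccontr)
      assume inf: "infinite S"
      have "ereal (real n) \<le> max_gen_degree I" for n
      proof -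
        obtain e where "e \<in> S" "n \<le> e"
          using inf by (metis finite_nat_set_iff_bounded_le nat_le_linear)
        then show ?thesis
          unfolding m_eq by (intro SUP_upper2[of e]) auto
      qed
      then have "ereal b \<le> max_gen_degree I" for b
        using real_arch_simple[of b] by (meson ereal_less_eq(3) order_trans)
      then show False
        using False ereal_top by blast
    qed
    define M where "M = Max S"
    have M_in: "M \<in> S" and M_max: "\<And>e. e \<in> S \<Longrightarrow> e \<le> M"
      using \<open>finite S\<close> e0(1) by (auto simp: M_def intro: Max_in)
    have M2: "M \<ge> 2" using M_max[OF e0(1)] e0(2) by simp
    have m: "max_gen_degree I = ereal (real M)"
      unfolding m_eq by (rule antisym) (auto intro!: SUP_least SUP_upper2[OF M_in] M_max)
    have Tor: "j \<le> Bd M i" if "Tor_nonzero \<pi> F i j" for i j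
    proof (rule Tor_bounded_of_Yoneda_generated[of "Bd M" "{1, 2}" i j])
      fix i j assume i: "i \<in> {1, 2 :: nat}" and j: "Bd M i < j"
      show "\<not> Tor_nonzero \<pi> F i j"
      proof (cases "i = 1")
        case True
        then show ?thesis using Tor_1_degree[of j] j by (simp add: Bd_def)
      next
        case False
        then have "i = 2" using i by simp
        then show ?thesis
          using Tor_2_le_max_gen_degree[of M j] M2 M_max j by (auto simp: S_def Bd_def)
      qed
    qed (use that assms(7) Bd_superadditive[OF M2] in \<open>simp_all add: Bd_def\<close>)
    have t_le: "t_deg \<pi> F i \<le> ereal (real_of_int (Bd M i))" for i
      unfolding t_deg_def by (rule Sup_least) (use Tor in auto)
    \<comment> \<open>\<open>Bd M 2 = M\<close> meets the lower bound from the minimal generators,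
      so the terms \<open>i = 2\<close> of both suprema already equal the claimed values.\<close>
    have "t_deg \<pi> F 2 = ereal (real M)"
      using t_le[of 2] max_gen_degree_le_t_deg by (simp add: m Bd_def)
    moreover have "rate \<pi> F \<le> ereal (real M - 1)"
      unfolding rate_def
    proof (rule SUP_least)
      fix i :: nat assume i: "i \<in> {2..}"
      have "(t_deg \<pi> F i - 1) / ereal (real i - 1) \<le> (ereal (real_of_int (Bd M i)) - 1) / ereal (real i - 1)"
        using i by (intro ereal_divide_right_mono ereal_minus_mono t_le) auto
      also have "\<dots> = ereal ((real_of_int (Bd M i) - 1) / (real i - 1))"
        using i by (simp add: one_ereal_def)
      also have "\<dots> \<le> ereal (real M - 1)"
        using i Bd_rate[OF M2, of i] by (simp add: divide_le_eq)
      finally show "(t_deg \<pi> F i - 1) / ereal (real i - 1) \<le> ereal (real M - 1)" .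
    qed
    moreover have "slant \<pi> F \<le> ereal (real M / 2)"
      unfolding slant_def
    proof (rule SUP_least)
      fix i :: nat assume i: "i \<in> {1..}"
      have "t_deg \<pi> F i / ereal (real i) \<le> ereal (real_of_int (Bd M i)) / ereal (real i)"
        using i by (intro ereal_divide_right_mono t_le) auto
      also have "\<dots> = ereal (real_of_int (Bd M i) / real i)"
        using i by simp
      also have "\<dots> \<le> ereal (real M / 2)"
        using i Bd_slant[OF M2, of i] by (simp add: divide_le_eq)
      finally show "t_deg \<pi> F i / ereal (real i) \<le> ereal (real M / 2)" .
    qed
    ultimately show ?thesis
      using rate_ge slant_ge by (simp add: m one_ereal_def order.antisym)
  qed
qed

end
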